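(* Let $G$ be an arithmetic semigroup satisfying Axiom A, with constants $A,\delta>0$ and $0\le\eta<\delta$. For every fixed $U>0$, as $x\to\infty$, \[ \Psi_G(x,y)=Ax^\delta\rho(u)+O\!\left(\frac{x^\delta}{\log x}\right),\qquad u=\frac{\log x}{\log y}, \] uniformly for $y\ge 2$ and $0<u\le U$. That is, for every $U>0$ there are constants $C,x_0>1$, depending only on $G$ (with its norm and Axiom A data) and $U$, such that $|\Psi_G(x,y)-Ax^\delta\rho(\log x/\log y)|\le C x^\delta/\log x$ for all $x\ge x_0$ and all $y\ge2$ with $0<\log x/\log y\le U$.
   Context: Arithmetic semigroup: a commutative semigroup $G$ (written multiplicatively) with identity $1$, together with a finite or countably infinite subset $P\subseteq G$ (the primes) such that every $g\in G\setminus\{1\}$ has a finite factorisation $g=p_1^{a_1}\cdots p_n^{a_n}$, unique up to ordering, with $n\ge1$, the $p_i\in P$ distinct and each $a_i\ge1$; and with a norm $|\cdot|:G\to[1,\infty)$ such that (i) $|1|=1$ and $|p|>1$ for $p\in P$; (ii) $|fg|=|f||g|$ for all $f,g\in G$; (iii) $N_G(x)=\#\{g\in G:|g|\le x\}$ is finite for each real $x>0$. Axiom A: there are constants $A>0$, $\delta>0$ and $0\le\eta<\delta$ such that $N_G(x)=Ax^\delta+O(x^\eta)$ as $x\to\infty$. Smooth elements: for $y\ge1$, $g\in G$ is $y$-smooth if every prime $p\in P$ appearing in its factorisation satisfies $|p|\le y$ (so $1$ is $y$-smooth). For $x,y\ge1$, $\Psi_G(x,y)$ is the number of $y$-smooth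 $g\in G$ with $|g|\le x$. Dickman function: $\rho:[0,\infty)\to\mathbb{R}$ is the unique continuous function, differentiable on $(1,\infty)$, with $\rho(u)=1$ for $0\le u\le1$ and $u\rho'(u)+\rho(u-1)=0$ for $u>1$. *)

theory Defs
  imports "HOL-Analysis.Analysis" "HOL-Library.Multiset" "HOL-Library.Landau_Symbols"
begin

text \<open>
  The semigroup \<open>G\<close> is the whole type \<open>'a\<close>. A factorisation
  \<open>p\<^sub>1^a\<^sub>1 \<cdots> p\<^sub>n^a\<^sub>n\<close>, taken up to ordering, is the multiset of primes
  in which each \<open>p\<^sub>i\<close> has multiplicity \<open>a\<^sub>i\<close>; \<open>n \<ge> 1\<close> says that it is nonempty.
\<close>

locale arithmetic_semigroup =
  fixes P :: "'a::comm_monoid_mult set"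
    and nrm :: "'a \<Rightarrow> real"
  assumes countable_primes: "countable P"
    and unique_factorisation:
      "g \<noteq> 1 \<Longrightarrow> \<exists>!M. M \<noteq> {#} \<and> set_mset M \<subseteq> P \<and> prod_mset M = g"
    and nrm_ge_1: "nrm g \<ge> 1"
    and nrm_one: "nrm 1 = 1"
    and nrm_prime: "p \<in> P \<Longrightarrow> nrm p > 1"
    and nrm_mult: "nrm (f * g) = nrm f * nrm g"
    and finite_nrm_le: "x > 0 \<Longrightarrow> finite {g. nrm g \<le> x}"

definition N_count :: "('a \<Rightarrow> real) \<Rightarrow> real \<Rightarrow> nat" where
  "N_count nrm x = card {g. nrm g \<le> x}"

definition axiom_A :: "('a \<Rightarrow> real) \<Rightarrow> real \<Rightarrow> real \<Rightarrow> real \<Rightarrow> bool" where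
  "axiom_A nrm A \<delta> \<eta> \<longleftrightarrow> A > 0 \<and> \<delta> > 0 \<and> 0 \<le> \<eta> \<and> \<eta> < \<delta> \<and>
     (\<lambda>x. real (N_count nrm x) - A * x powr \<delta>) \<in> O[at_top](\<lambda>x. x powr \<eta>)"

definition factorisation :: "'a::comm_monoid_mult set \<Rightarrow> 'a \<Rightarrow> 'a multiset" where
  "factorisation P g = (THE M. set_mset M \<subseteq> P \<and> prod_mset M = g)"

definition smooth :: "'a::comm_monoid_mult set \<Rightarrow> ('a \<Rightarrow> real) \<Rightarrow> real \<Rightarrow> 'a \<Rightarrow> bool" where
  "smooth P nrm y g \<longleftrightarrow> (\<forall>p \<in># factorisation P g. nrm p \<le> y)"

definition Psi :: "'a::comm_monoid_mult set \<Rightarrow> ('a \<Rightarrow> real) \<Rightarrow> real \<Rightarrow> real \<Rightarrow> nat" where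
  "Psi P nrm x y = card {g. smooth P nrm y g \<and> nrm g \<le> x}"

text \<open>
  The factorisation of \<open>1\<close> is not covered by the axiom on factorisations, but the empty one
  is the only one, since primes have norm greater than \<open>1\<close>.
\<close>

lemma (in arithmetic_semigroup) nrm_prod_mset:
  "set_mset M \<subseteq> P \<Longrightarrow> M \<noteq> {#} \<Longrightarrow> nrm (prod_mset M) > 1"
proof (induction M)
  case (add p M)
  have "nrm (prod_mset (add_mset p M)) = nrm p * nrm (prod_mset M)"
    by (simp add: nrm_mult)
  moreover have "nrm p * 1 \<le> nrm p * nrm (prod_mset M)"
    using nrm_ge_1[of p] nrm_ge_1[of "prod_mset M"] by (intro mult_left_mono) auto
  moreover have "nrm p > 1"
    using add.prems by (intro nrm_prime) auto
  ultimately show ?case by linarith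
qed simp

lemma (in arithmetic_semigroup) ex1_factorisation:
  "\<exists>!M. set_mset M \<subseteq> P \<and> prod_mset M = g"
proof (cases "g = 1")
  case True
  show ?thesis
  proof (rule ex1I[of _ "{#}"])
    fix M assume "set_mset M \<subseteq> P \<and> prod_mset M = g"
    then show "M = {#}" using nrm_prod_mset[of M] nrm_one True by auto
  qed (use True in auto)
next
  case False
  obtain M where M: "set_mset M \<subseteq> P" "prod_mset M = g"
    and uniq: "\<And>M'. M' \<noteq> {#} \<and> set_mset M' \<subseteq> P \<and> prod_mset M' = g \<Longrightarrow> M' = M"
    using unique_factorisation[OF False] by blast
  show ?thesis
  proof (rule ex1I[of _ M])
    fix M' assume "set_mset M' \<subseteq> P \<and> prod_mset M' = g"
    then show "M' = M" using False by (intro uniq) auto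
  qed (use M in auto)
qed

lemma (in arithmetic_semigroup) factorisation:
  "set_mset (factorisation P g) \<subseteq> P" "prod_mset (factorisation P g) = g"
  using theI'[OF ex1_factorisation[of g]] unfolding factorisation_def by auto

lemma (in arithmetic_semigroup) smooth_1: "smooth P nrm y 1"
proof -
  have "factorisation P 1 = {#}"
    using ex1_factorisation[of 1] factorisation[of 1] by (metis empty_subsetI prod_mset_empty set_mset_empty)
  then show ?thesis by (simp add: smooth_def)
qed

definition is_dickman :: "(real \<Rightarrow> real) \<Rightarrow> bool" where
  "is_dickman r \<longleftrightarrow> continuous_on {0..} r \<and>
     (\<forall>u\<in>{0..1}. r u = 1) \<and>
     (\<forall>u>1. r differentiable (at u) \<and> u * deriv r u + r (u - 1) = 0)"

text \<open>
  The Dickman function lives on \<open>[0, \<infinity>)\<close>; extending it by \<open>0\<close> to the negative reals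
  makes it unique as a function on the whole type.
\<close>

definition dickman :: "real \<Rightarrow> real" where
  "dickman = (THE r. is_dickman r \<and> (\<forall>u<0. r u = 0))"

lemma is_dickman_unique_le:
  fixes n :: nat
  assumes r: "is_dickman r" and s: "is_dickman s" and "0 \<le> u" "u \<le> real (Suc n)"
  shows "r u = s u"
  using assms(3,4)
proof (induction n arbitrary: u)
  case 0
  then show ?case using r s by (auto simp: is_dickman_def)
next
  case (Suc n)
  let ?d = "\<lambda>u. r u - s u"
  let ?a = "real (Suc n)"
  show ?case
  proof (cases "u \<le> ?a")
    case True
    then show ?thesis using Suc by auto
  next
    case False
    have der: "(?d has_real_derivative 0) (at v)" if v: "?a < v" "v \<le> real (Suc (Suc n))" for v
    proof -
      have v1: "v > 1" using v by auto
      have "r differentiable (at v)" "v * deriv r v + r (v - 1) = 0"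
        "s differentiable (at v)" "v * deriv s v + s (v - 1) = 0"
        using r s v1 unfolding is_dickman_def by auto
      moreover have "r (v - 1) = s (v - 1)"
        using v by (intro Suc.IH) auto
      ultimately have "v * deriv r v = v * deriv s v" by linarith
      then have eq: "deriv r v = deriv s v" using v1 by simp
      have "(r has_real_derivative deriv r v) (at v)" "(s has_real_derivative deriv s v) (at v)"
        using \<open>r differentiable (at v)\<close> \<open>s differentiable (at v)\<close>
        by (auto simp: DERIV_deriv_iff_real_differentiable)
      from DERIV_diff[OF this] show ?thesis using eq by simp
    qed
    have "continuous_on {0..} ?d"
      using r s by (auto simp: is_dickman_def intro!: continuous_intros)
    then have "continuous_on {?a..u} ?d"
      by (rule continuous_on_subset) auto
    then have "?d u = ?d ?a"
      using False Suc.prems der by (intro DERIV_isconst_end) auto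
    moreover have "r ?a = s ?a" by (rule Suc.IH) auto
    ultimately show ?thesis by simp
  qed
qed

lemma is_dickman_unique:
  assumes "is_dickman r" "is_dickman s" "0 \<le> u"
  shows "r u = s u"
proof -
  obtain n :: nat where "u \<le> real n" using real_arch_simple by blast
  then show ?thesis using is_dickman_unique_le[OF assms, of n] by auto
qed

definition dickman_step :: "(real \<Rightarrow> real) \<Rightarrow> real \<Rightarrow> real" where
  "dickman_step f u = (if u < 0 then 0 else if u \<le> 1 then 1
     else 1 - integral {1..u} (\<lambda>t. f (t - 1) / t))"

lemma dickman_step_props:
  assumes f: "continuous_on {0..} f"
  shows "u > 1 \<Longrightarrow> (dickman_step f has_real_derivative - (f (u - 1) / u)) (at u)"
    and "continuous_on {0..} (dickman_step f)"
proof -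
  have cont: "continuous_on {1..b} (\<lambda>t. f (t - 1) / t)" for b
    by (intro continuous_intros continuous_on_compose2[OF f]) auto
  show der: "(dickman_step f has_real_derivative - (f (u - 1) / u)) (at u)" if u: "u > 1" for u
  proof -
    have "((\<lambda>v. integral {1..v} (\<lambda>t. f (t - 1) / t)) has_real_derivative f (u - 1) / u)
        (at u within {1..u+1})"
      using u by (intro integral_has_real_derivative cont) auto
    then have "((\<lambda>v. integral {1..v} (\<lambda>t. f (t - 1) / t)) has_real_derivative f (u - 1) / u)
        (at u)"
      using u by (simp add: at_within_Icc_at)
    then have "((\<lambda>v. 1 - integral {1..v} (\<lambda>t. f (t - 1) / t)) has_real_derivative
        - (f (u - 1) / u)) (at u)"
      by (auto intro!: derivative_eq_intros)
    then show ?thesis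
      by (rule has_field_derivative_transform_within_open[of _ _ _ "{1<..}"])
        (use u in \<open>auto simp: dickman_step_def\<close>)
  qed
  have "continuous_on {1..b} (dickman_step f)" for b
  proof -
    have "continuous_on {1..b} (\<lambda>v. 1 - integral {1..v} (\<lambda>t. f (t - 1) / t))"
      by (intro continuous_intros indefinite_integral_continuous_1 integrable_continuous_real cont)
    then show ?thesis
      by (rule continuous_on_eq) (auto simp: dickman_step_def)
  qed
  then have "continuous_on {0..1} (dickman_step f)" "continuous_on {1..b} (dickman_step f)" for b
    by (auto intro: continuous_on_eq[OF continuous_on_const[of _ 1]] simp: dickman_step_def)
  then have *: "continuous_on ({0..1} \<union> {1..b}) (dickman_step f)" for b
    by (intro continuous_on_closed_Un) auto
  show "continuous_on {0..} (dickman_step f)"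
    unfolding continuous_on_eq_continuous_within
  proof
    fix u :: real assume u: "u \<in> {0..}"
    have "continuous (at u within ({0..1} \<union> {1..u+1})) (dickman_step f)"
      using *[of "u+1"] u by (auto simp: continuous_on_eq_continuous_within)
    moreover have "at u within ({0..1} \<union> {1..u+1}) = at u within {0..}"
      by (rule at_within_nhd[of _ "{..<u+1}"]) (use u in auto)
    ultimately show "continuous (at u within {0..}) (dickman_step f)" by simp
  qed
qed

lemma dickman_step_cong:
  assumes "\<And>v. v \<le> u - 1 \<Longrightarrow> f v = g v"
  shows "dickman_step f u = dickman_step g u"
  using assms by (auto simp: dickman_step_def intro!: Henstock_Kurzweil_Integration.integral_cong)

lemma is_dickman_exists: "\<exists>r. is_dickman r \<and> (\<forall>u<0. r u = 0)"
proof -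
  define F where "F n = (dickman_step ^^ n) (\<lambda>u. if u < 0 then 0 else 1)" for n
  have F_Suc: "F (Suc n) = dickman_step (F n)" for n by (simp add: F_def)
  have F_cont: "continuous_on {0..} (F n)" for n
  proof (induction n)
    case 0
    show ?case by (auto simp: F_def intro: continuous_on_eq[OF continuous_on_const[of _ 1]])
  qed (simp add: F_Suc dickman_step_props)
  have F_eq1: "F (Suc n) u = F n u" if "u \<le> real (Suc n)" for n u
    using that
  proof (induction n arbitrary: u)
    case 0
    then show ?case by (simp add: F_def dickman_step_def)
  next
    case (Suc n)
    show ?case unfolding F_Suc[of "Suc n"] F_Suc[of n]
      by (rule dickman_step_cong) (use Suc F_Suc in auto)
  qed
  have F_eq: "F (n + k) u = F n u" if "u \<le> real (Suc n)" for n k u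
    using that by (induction k) (auto simp: F_eq1)
  define r where "r u = F (nat \<lceil>u\<rceil>) u" for u
  have r_eq: "r u = F n u" if "u \<le> real n" for n u
  proof -
    have "nat \<lceil>u\<rceil> \<le> n" using that by linarith
    then obtain k where "n = nat \<lceil>u\<rceil> + k" using le_Suc_ex by blast
    moreover have "u \<le> real (Suc (nat \<lceil>u\<rceil>))" by linarith
    ultimately show ?thesis using F_eq by (simp add: r_def)
  qed
  have r_step: "r u = dickman_step r u" for u
  proof -
    obtain n :: nat where n: "u \<le> real n" using real_arch_simple by blast
    have "r u = F (Suc n) u" using n by (intro r_eq) auto
    also have "\<dots> = dickman_step r u"
      unfolding F_Suc by (intro dickman_step_cong r_eq[symmetric]) (use n in simp)
    finally show ?thesis .
  qed
  have "continuous_on {0..} r"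
    unfolding continuous_on_eq_continuous_within
  proof
    fix u :: real assume u: "u \<in> {0..}"
    obtain n :: nat where n: "u < real n" using reals_Archimedean2 by blast
    have "continuous_on {0..real n} (F n)"
      by (rule continuous_on_subset[OF F_cont]) auto
    then have "continuous_on {0..real n} r"
      by (rule continuous_on_eq) (auto simp: r_eq)
    then have "continuous (at u within {0..real n}) r"
      using u n by (auto simp: continuous_on_eq_continuous_within)
    moreover have "at u within {0..real n} = at u within {0..}"
      by (rule at_within_nhd[of _ "{..<real n}"]) (use u n in auto)
    ultimately show "continuous (at u within {0..}) r" by simp
  qed
  note r_cont = this
  have "dickman_step r = r" using r_step by (intro ext) (rule sym)
  then have r_der: "(r has_real_derivative - (r (u - 1) / u)) (at u)" if "u > 1" for u
    using dickman_step_props(1)[OF r_cont that] by simp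
  have "r u = 1" if "u \<in> {0..1}" for u
    using that by (subst r_step) (auto simp: dickman_step_def)
  moreover have "r differentiable (at u) \<and> u * deriv r u + r (u - 1) = 0" if "u > 1" for u
    using r_der[OF that] DERIV_imp_deriv[OF r_der[OF that]] that
    by (auto simp: real_differentiable_def)
  ultimately have "is_dickman r"
    unfolding is_dickman_def using r_cont by blast
  moreover have "r u = 0" if "u < 0" for u
    using that by (subst r_step) (auto simp: dickman_step_def)
  ultimately show ?thesis by blast
qed

lemma dickman: "is_dickman dickman" "u < 0 \<Longrightarrow> dickman u = 0"
proof -
  have "\<exists>!r. is_dickman r \<and> (\<forall>u<0. r u = 0)"
  proof (rule ex_ex1I[OF is_dickman_exists])
    fix r s
    assume "is_dickman r \<and> (\<forall>u<0. r u = 0)" "is_dickman s \<and> (\<forall>u<0. s u = 0)"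
    then have "r u = s u" for u
      using is_dickman_unique[of r s u] by (cases "u < 0") auto
    then show "r = s" by blast
  qed
  from theI'[OF this] show "is_dickman dickman" "u < 0 \<Longrightarrow> dickman u = 0"
    unfolding dickman_def by auto
qed

end

theory Submission
  imports Defs
begin

text \<open>
  After replacing the norm by its \<open>\<delta>\<close>-th power we may take \<open>\<delta> = 1\<close>. Counting the prime
  factors of all elements of norm at most \<open>x\<close> gives
  \<open>\<Sum>p. ln (nrm p) * N (x / nrm p) = A x ln x + O(x)\<close>, whence a Chebyshev bound and Mertens'
  theorem \<open>\<Sum>p. ln (nrm p) / nrm p = ln x + O(1)\<close>; the prime number theorem is not needed.
  The estimate for \<open>u \<le> n + 1\<close> then follows from that for \<open>u \<le> n\<close> by Buchstab's identity
  \<open>Psi x y = N x - (\<Sum>y < nrm p \<le> x. Psi (x / nrm p) (nrm p))\<close>, in which the sum of the main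
  terms is evaluated by partial summation against Mertens' theorem: its limit is
  \<open>1 - dickman u\<close> because \<open>t \<mapsto> dickman (L / t)\<close> has derivative \<open>dickman (L / t - 1) / t\<close>.
\<close>

subsection \<open>Factorisations and counting\<close>

text \<open>The difference T1(x) - 2 T1(x/2) behind Chebyshev's bound for integers gives nothing
  here: its weight \<open>N z - 2 * N (z / 2)\<close> is merely O(\<open>z powr \<eta>\<close>), of
  unknown sign. Averaging over many dilations leaves a positive surplus instead. The bound is sought
  in the form \<Sum> \<open>ln (nrm p) * (x / nrm p) powr \<eta>\<close> = O(x) because this is what
  replacing \<open>N (x / nrm p)\<close> by its main term costs; the same sum serves Mertens'
  theorem and, in the induction, the primes above the square root of \<open>x\<close>. An O(1) error
  in Mertens' theorem suffices for the following reason. With L = ln x, the function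
  \<open>dickman (L / t - 1) / t\<close> on [L/U, L] is O(1/L) with Lipschitz constant O(1/L^2), and
  the interval has length at most L, so a bounded discrepancy costs O(1/L), the relative error
  claimed. Unlike for integers, primes may share a norm, and their norms are only known to exceed
  1.\<close>

lemma sum_mset_eq_sum_count:
  assumes "finite S" "set_mset M \<subseteq> S"
  shows "(\<Sum>x\<in>#M. f x) = (\<Sum>x\<in>S. real (count M x) * f x)"
  using assms(2)
proof (induction M)
  case (add y M)
  have "(\<Sum>x\<in>S. real (count (add_mset y M) x) * f x)
      = (\<Sum>x\<in>S. real (count M x) * f x + (if x = y then f x else 0))"
    by (intro sum.cong) (auto simp: algebra_simps)
  then show ?case using add assms(1) by (simp add: sum.distrib)
qed simp

context arithmetic_semigroup
begin

lemma factorisation_prod_mset: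
  assumes "set_mset M \<subseteq> P"
  shows "factorisation P (prod_mset M) = M"
  using ex1_factorisation[of "prod_mset M"] factorisation[of "prod_mset M"] assms by blast

lemma factorisation_mult:
  "factorisation P (f * g) = factorisation P f + factorisation P g"
proof -
  have "factorisation P (prod_mset (factorisation P f + factorisation P g))
      = factorisation P f + factorisation P g"
    by (intro factorisation_prod_mset) (use factorisation(1) in auto)
  then show ?thesis by (simp add: factorisation(2))
qed

lemma factorisation_prime: "p \<in> P \<Longrightarrow> factorisation P p = {#p#}"
  using factorisation_prod_mset[of "{#p#}"] by simp

text \<open>Cancellation is not an axiom of \<open>G\<close>; it is inherited from multisets through
  the additivity of \<open>factorisation\<close>.\<close>

lemma mult_left_cancel: "(f :: 'a) * g = f * h \<longleftrightarrow> g = h"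
proof
  assume "f * g = f * h"
  then have "factorisation P g = factorisation P h"
    using factorisation_mult[of f g] factorisation_mult[of f h] by simp
  then show "g = h" by (metis factorisation(2)[of g] factorisation(2)[of h])
qed simp

lemma factor_of_mem_factorisation:
  assumes "p \<in># factorisation P g"
  obtains h where "g = p * h"
proof -
  obtain M where "factorisation P g = add_mset p M"
    using assms by (metis insert_DiffM)
  then have "g = p * prod_mset M" using factorisation(2)[of g] by simp
  then show ?thesis using that by blast
qed

lemma mem_factorisation_prime: "p \<in># factorisation P g \<Longrightarrow> p \<in> P"
  using factorisation(1) by auto

lemma nrm_pos: "nrm g > 0"
  using nrm_ge_1[of g] by linarith

lemma nrm_le_of_mem_factorisation:
  assumes "p \<in># factorisation P g"
  shows "nrm p \<le> nrm g"
proof -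
  obtain h where "g = p * h" using assms factor_of_mem_factorisation by blast
  then show ?thesis
    using nrm_ge_1[of h] nrm_pos[of p] by (simp add: nrm_mult)
qed

lemma elems_empty:
  assumes "x < 1"
  shows "{g. nrm g \<le> x} = {}"
proof -
  have "\<not> nrm g \<le> x" for g using nrm_ge_1[of g] assms by linarith
  then show ?thesis by blast
qed

lemma finite_elems: "finite {g. nrm g \<le> x}"
proof (cases "x > 0")
  case False
  then have "{g. nrm g \<le> x} = {}" by (intro elems_empty) auto
  then show ?thesis by (simp only: finite.emptyI)
qed (rule finite_nrm_le)

lemma finite_primes_le: "finite {p \<in> P. nrm p \<le> x}"
  by (rule finite_subset[OF _ finite_elems[of x]]) auto

lemma N_count_eq_0: "x < 1 \<Longrightarrow> N_count nrm x = 0"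
  by (simp only: N_count_def elems_empty card.empty)

lemma N_count_ge_1: "x \<ge> 1 \<Longrightarrow> N_count nrm x \<ge> 1"
proof -
  assume "x \<ge> 1"
  then have "1 \<in> {g. nrm g \<le> x}" using nrm_one by simp
  then have "card {g. nrm g \<le> x} > 0" using finite_elems card_gt_0_iff by blast
  then show ?thesis by (simp add: N_count_def)
qed

lemma N_count_mono: "x \<le> y \<Longrightarrow> N_count nrm x \<le> N_count nrm y"
  unfolding N_count_def by (intro card_mono finite_elems) auto

lemma multiples_eq_image:
  assumes "p \<in> P"
  shows "{g. nrm g \<le> x \<and> p \<in># factorisation P g} = (*) p ` {h. nrm h \<le> x / nrm p}"
proof (intro set_eqI iffI)
  fix g assume g: "g \<in> {g. nrm g \<le> x \<and> p \<in># factorisation P g}"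
  then obtain h where "g = p * h" using factor_of_mem_factorisation by blast
  then show "g \<in> (*) p ` {h. nrm h \<le> x / nrm p}"
    using g nrm_pos[of p] by (auto simp: nrm_mult field_simps)
next
  fix g assume "g \<in> (*) p ` {h. nrm h \<le> x / nrm p}"
  then show "g \<in> {g. nrm g \<le> x \<and> p \<in># factorisation P g}"
    using nrm_pos[of p] assms
    by (auto simp: nrm_mult field_simps factorisation_mult factorisation_prime)
qed

text \<open>One step of Legendre's formula: each multiple of \<open>p\<close> gives up one copy of
  \<open>p\<close>. Iteration would produce the sum of \<open>N_count nrm (x / nrm p ^ k)\<close>
  over k \<ge> 1.\<close>

lemma sum_count_factorisation:
  assumes p: "p \<in> P"
  shows "(\<Sum>g | nrm g \<le> x. real (count (factorisation P g) p))
    = real (N_count nrm (x / nrm p))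
      + (\<Sum>g | nrm g \<le> x / nrm p. real (count (factorisation P g) p))"
proof -
  let ?c = "\<lambda>g. real (count (factorisation P g) p)"
  have "(\<Sum>g | nrm g \<le> x. ?c g) = (\<Sum>g | nrm g \<le> x \<and> p \<in># factorisation P g. ?c g)"
    by (rule sum.mono_neutral_right) (auto simp: finite_elems not_in_iff)
  also have "\<dots> = (\<Sum>h | nrm h \<le> x / nrm p. ?c (p * h))"
    unfolding multiples_eq_image[OF p]
    by (subst sum.reindex) (auto simp: inj_on_def mult_left_cancel)
  also have "\<dots> = (\<Sum>h | nrm h \<le> x / nrm p. 1 + ?c h)"
    by (intro sum.cong) (auto simp: factorisation_mult factorisation_prime p)
  finally show ?thesis by (simp add: sum.distrib N_count_def)
qed

lemma ln_nrm: "ln (nrm g) = (\<Sum>p\<in>#factorisation P g. ln (nrm p))"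
proof -
  have "ln (nrm (prod_mset M)) = (\<Sum>p\<in>#M. ln (nrm p))" for M :: "'a multiset"
    by (induction M) (auto simp: nrm_one nrm_mult ln_mult_pos nrm_pos)
  then show ?thesis by (metis factorisation(2))
qed

lemma ln_nrm_eq_sum:
  assumes "nrm g \<le> x"
  shows "ln (nrm g) = (\<Sum>p | p \<in> P \<and> nrm p \<le> x. real (count (factorisation P g) p) * ln (nrm p))"
proof -
  have "set_mset (factorisation P g) \<subseteq> {p. p \<in> P \<and> nrm p \<le> x}"
    using mem_factorisation_prime nrm_le_of_mem_factorisation assms by force
  then show ?thesis
    by (subst ln_nrm) (intro sum_mset_eq_sum_count finite_primes_le)
qed

text \<open>The analogue of factoring n! into primes: the double sum over elements and their prime
  factors is interchanged.\<close>

lemma sum_ln_nrm: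
  "(\<Sum>g | nrm g \<le> x. ln (nrm g))
    = (\<Sum>p | p \<in> P \<and> nrm p \<le> x. ln (nrm p) *
        (\<Sum>g | nrm g \<le> x. real (count (factorisation P g) p)))"
proof -
  have "(\<Sum>g | nrm g \<le> x. ln (nrm g)) = (\<Sum>g | nrm g \<le> x.
      \<Sum>p | p \<in> P \<and> nrm p \<le> x. real (count (factorisation P g) p) * ln (nrm p))"
    by (intro sum.cong refl ln_nrm_eq_sum) auto
  also have "\<dots> = (\<Sum>p | p \<in> P \<and> nrm p \<le> x. \<Sum>g | nrm g \<le> x.
      real (count (factorisation P g) p) * ln (nrm p))"
    by (rule sum.swap)
  finally show ?thesis by (simp add: sum_distrib_left mult.commute)
qed

end

text \<open>Axiom A with density exponent 1. The bound holds from \<open>x = 1\<close> on with an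
  explicit constant, so that it applies to \<open>x / nrm p\<close> for every prime of norm at most
  \<open>x\<close>, however close the quotient is to 1.\<close>

locale axiom_A_semigroup = arithmetic_semigroup P nrm
  for P :: "'a::comm_monoid_mult set" and nrm :: "'a \<Rightarrow> real" +
  fixes A \<eta> K :: real
  assumes A_pos: "A > 0" and eta_nonneg: "0 \<le> \<eta>" and eta_less_1: "\<eta> < 1" and K_pos: "K > 0"
    and N_bound: "x \<ge> 1 \<Longrightarrow> \<bar>real (N_count nrm x) - A * x\<bar> \<le> K * x powr \<eta>"
begin

abbreviation N :: "real \<Rightarrow> real" where "N x \<equiv> real (N_count nrm x)"

abbreviation elems :: "real \<Rightarrow> 'a set" where "elems x \<equiv> {g. nrm g \<le> x}"

abbreviation primes :: "real \<Rightarrow> 'a set" where "primes x \<equiv> {p. p \<in> P \<and> nrm p \<le> x}"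

lemma primeD: "p \<in> P \<Longrightarrow> ln (nrm p) > 0" "p \<in> P \<Longrightarrow> nrm p > 1"
  using nrm_prime[of p] by auto

section \<open>Elementary sums under Axiom A\<close>

definition C0 :: real where "C0 = A + K"

lemma C0_pos: "C0 > 0" using A_pos K_pos by (simp add: C0_def)

lemma powr_eta_le: "x \<ge> 1 \<Longrightarrow> x powr \<eta> \<le> x"
  using powr_mono[of \<eta> 1 x] eta_less_1 by simp

lemma N_le: "x > 0 \<Longrightarrow> N x \<le> C0 * x"
proof (cases "x \<ge> 1")
  case True
  have "K * x powr \<eta> \<le> K * x"
    using powr_eta_le[OF True] K_pos by simp
  then show ?thesis using N_bound[OF True] by (simp add: C0_def algebra_simps)
next
  case False
  assume "x > 0"
  then show ?thesis using C0_pos False by (simp add: N_count_eq_0)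
qed

text \<open>Passing from \<open>x\<close> to \<open>x / 2\<close> costs each element at most ln 2 <
  1, hence at most \<open>N x\<close> \<le> \<open>C0 * x\<close> in all; the halvings add up to a
  geometric series.\<close>

lemma sum_ln_quotient_le:
  assumes "x > 0"
  shows "(\<Sum>g\<in>elems x. ln (x / nrm g)) \<le> 2 * C0 * x"
proof -
  obtain n where "x < 2 ^ n" using real_arch_pow[of 2 x] by auto
  then show ?thesis using assms
  proof (induction n arbitrary: x)
    case 0
    then have "elems x = {}" by (intro elems_empty) auto
    then have "(\<Sum>g\<in>elems x. ln (x / nrm g)) = 0" by (simp only: sum.empty)
    then show ?case using C0_pos 0 by (simp del: Collect_empty_eq)
  next
    case (Suc n)
    have "(\<Sum>g\<in>elems x. ln (x / nrm g))
        \<le> (\<Sum>g\<in>elems x. 1 + (if nrm g \<le> x/2 then ln (x / 2 / nrm g) else 0))"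
    proof (rule sum_mono)
      fix g assume g: "g \<in> elems x"
      show "ln (x / nrm g) \<le> 1 + (if nrm g \<le> x/2 then ln (x / 2 / nrm g) else 0)"
      proof (cases "nrm g \<le> x/2")
        case True
        have "ln (x / nrm g) = ln 2 + ln (x / 2 / nrm g)"
          using Suc nrm_pos[of g] by (subst ln_mult_pos[symmetric]) auto
        then show ?thesis using True ln_2_less_1 by simp
      next
        case False
        have "ln (x / nrm g) \<le> ln 2"
          using False Suc nrm_pos[of g] by (subst ln_le_cancel_iff) (auto simp: field_simps)
        then show ?thesis using False ln_2_less_1 by simp
      qed
    qed
    also have "\<dots> = N x + (\<Sum>g\<in>elems (x/2). ln (x / 2 / nrm g))"
    proof -
      have "{g \<in> elems x. nrm g \<le> x/2} = elems (x/2)" using Suc by auto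
      then show ?thesis
        by (simp add: sum.distrib N_count_def flip: sum.inter_filter[OF finite_elems])
    qed
    also have "\<dots> \<le> C0 * x + 2 * C0 * (x/2)"
      by (intro add_mono N_le Suc.IH) (use Suc in auto)
    finally show ?case by (simp add: mult_ac)
  qed
qed

lemma ln_le_powr: "x \<ge> 1 \<Longrightarrow> x powr \<eta> * ln x \<le> x / (1 - \<eta>)"
proof -
  assume x: "x \<ge> 1"
  have "ln x \<le> x powr (1 - \<eta>) / (1 - \<eta>)"
    using x eta_less_1 by (intro ln_powr_bound) auto
  then have "x powr \<eta> * ln x \<le> x powr \<eta> * (x powr (1 - \<eta>) / (1 - \<eta>))"
    by (intro mult_left_mono) auto
  also have "\<dots> = x / (1 - \<eta>)"
    using x by (simp flip: powr_add)
  finally show ?thesis .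
qed

text \<open>The substitute for Stirling's formula: the sum equals \<open>N x * ln x\<close> minus
  the sum of \<open>ln (x / nrm g)\<close>, and \<open>x powr \<eta> * ln x\<close> is O(x) because
  \<open>\<eta> < 1\<close>.\<close>

lemma sum_ln_bound:
  assumes "x \<ge> 1"
  shows "\<bar>(\<Sum>g\<in>elems x. ln (nrm g)) - A * x * ln x\<bar> \<le> (K / (1 - \<eta>) + 2 * C0) * x"
proof -
  let ?L = "\<Sum>g\<in>elems x. ln (x / nrm g)"
  have "?L = (\<Sum>g\<in>elems x. ln x - ln (nrm g))"
    using assms less_imp_neq[OF nrm_pos, symmetric] by (intro sum.cong) (simp_all add: ln_div)
  then have "(\<Sum>g\<in>elems x. ln (nrm g)) = N x * ln x - ?L"
    by (simp add: sum_subtractf N_count_def)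
  moreover have "?L \<le> 2 * C0 * x" using assms by (intro sum_ln_quotient_le) auto
  moreover have "?L \<ge> 0"
    using nrm_pos by (intro sum_nonneg ln_ge_zero) (simp add: pos_le_divide_eq)
  moreover have "\<bar>N x * ln x - A * x * ln x\<bar> \<le> K / (1 - \<eta>) * x"
  proof -
    have "N x * ln x - A * x * ln x = (N x - A * x) * ln x" by (simp add: algebra_simps)
    then have "\<bar>N x * ln x - A * x * ln x\<bar> = \<bar>N x - A * x\<bar> * ln x"
      using assms by (simp add: abs_mult)
    also have "\<dots> \<le> K * x powr \<eta> * ln x"
      using assms by (intro mult_right_mono N_bound) auto
    also have "\<dots> \<le> K * (x / (1 - \<eta>))"
      unfolding mult.assoc using assms K_pos by (intro mult_left_mono ln_le_powr) auto
    finally show ?thesis by simp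
  qed
  ultimately show ?thesis by (simp add: distrib_right)
qed

text \<open>Cut into shells 4^J < \<open>nrm g\<close> \<le> 4^(J+1): powers of 4 keep the square
  roots exact, and a shell has at most \<open>C0\<close> 4^(J+1) elements, each contributing at most
  1/8^J.\<close>

lemma sum_inverse_three_halves_le:
  "(\<Sum>g\<in>elems x. 1 / (nrm g * sqrt (nrm g))) \<le> 9 * C0"
proof -
  \<comment> \<open>The bound is built to telescope: 8/2^J - 8/2^(J+1) = 4/2^J is the share of one
    shell, and at J = 0 it leaves \<open>C0\<close>.\<close>
  have *: "(\<Sum>g\<in>elems (4^J). 1 / (nrm g * sqrt (nrm g))) \<le> C0 * (9 - 8 / 2^J)" for J :: nat
  proof (induction J)
    case 0
    have "(\<Sum>g\<in>elems 1. 1 / (nrm g * sqrt (nrm g))) \<le> (\<Sum>g\<in>elems 1. 1)"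
    proof (intro sum_mono)
      fix g
      have "1 * 1 \<le> nrm g * sqrt (nrm g)"
        using nrm_ge_1[of g] by (intro mult_mono) auto
      then show "1 / (nrm g * sqrt (nrm g)) \<le> 1" by simp
    qed
    also have "\<dots> \<le> C0" using N_le[of 1] by (simp add: N_count_def)
    finally show ?case by simp
  next
    case (Suc J)
    let ?D = "elems (4^Suc J) - elems (4^J)"
    have sub: "elems (4^J) \<subseteq> elems (4^Suc J)"
    proof -
      have "(4::real)^J \<le> 4^Suc J" by simp
      then show ?thesis using order_trans by blast
    qed
    have "(\<Sum>g\<in>?D. 1 / (nrm g * sqrt (nrm g))) \<le> (\<Sum>g\<in>?D. 1 / 8^J)"
    proof (intro sum_mono)
      fix g assume g: "g \<in> ?D"
      then have g': "4^J \<le> nrm g" by auto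
      have "2^J = sqrt (4^J)" by (simp add: real_sqrt_power)
      then have "(2::real)^J \<le> sqrt (nrm g)" using g' by simp
      then have "(4::real)^J * 2^J \<le> nrm g * sqrt (nrm g)"
        using g' nrm_pos[of g] by (intro mult_mono) auto
      moreover have "(4::real)^J * 2^J = 8^J" by (simp flip: power_mult_distrib)
      ultimately show "1 / (nrm g * sqrt (nrm g)) \<le> 1 / 8^J"
        by (intro divide_left_mono) (use nrm_pos[of g] in auto)
    qed
    also have "\<dots> = card ?D / 8^J" by simp
    also have "\<dots> \<le> N (4^Suc J) / 8^J"
      unfolding N_count_def
      by (intro divide_right_mono) (auto intro!: card_mono finite_elems)
    also have "\<dots> \<le> C0 * 4^Suc J / 8^J"
      by (intro divide_right_mono N_le) auto
    also have "(8::real)^J = 4^J * 2^J" by (simp flip: power_mult_distrib)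
    finally have "(\<Sum>g\<in>?D. 1 / (nrm g * sqrt (nrm g))) \<le> C0 * (4 / 2^J)"
      by simp
    moreover have "(\<Sum>g\<in>elems (4^Suc J). 1 / (nrm g * sqrt (nrm g)))
        = (\<Sum>g\<in>?D. 1 / (nrm g * sqrt (nrm g))) + (\<Sum>g\<in>elems (4^J). 1 / (nrm g * sqrt (nrm g)))"
      by (rule sum.subset_diff[OF sub finite_elems])
    ultimately have "(\<Sum>g\<in>elems (4^Suc J). 1 / (nrm g * sqrt (nrm g)))
        \<le> C0 * (4 / 2^J) + C0 * (9 - 8 / 2^J)" using Suc by linarith
    also have "\<dots> = C0 * (9 - 8 / 2^Suc J)" by (simp add: field_simps)
    finally show ?case .
  qed
  obtain J where J: "x < 4 ^ J" using real_arch_pow[of 4 x] by auto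
  have "(\<Sum>g\<in>elems x. 1 / (nrm g * sqrt (nrm g))) \<le> (\<Sum>g\<in>elems (4^J). 1 / (nrm g * sqrt (nrm g)))"
    using J nrm_pos by (intro sum_mono2 finite_elems) (auto simp: less_imp_le)
  also have "\<dots> \<le> C0 * (9 - 8 / 2^J)" by (rule *)
  also have "\<dots> \<le> C0 * 9" using C0_pos by (intro mult_left_mono) auto
  finally show ?thesis by simp
qed

text \<open>Legendre's formula with \<open>N z\<close> \<le> \<open>C0 * z\<close> is a geometric
  series in \<open>1 / nrm p\<close>; the induction counts the divisions by \<open>nrm p\<close>
  that bring \<open>x\<close> below 1.\<close>

lemma sum_count_le:
  assumes p: "p \<in> P" and "x > 0"
  shows "(\<Sum>g\<in>elems x. real (count (factorisation P g) p)) \<le> C0 * x / (nrm p - 1)"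
proof -
  note p1 = primeD(2)[OF p]
  obtain n where "x < nrm p ^ n" using real_arch_pow[OF p1] by auto
  then show ?thesis using \<open>x > 0\<close>
  proof (induction n arbitrary: x)
    case 0
    then have "elems x = {}" by (intro elems_empty) auto
    then have "(\<Sum>g\<in>elems x. real (count (factorisation P g) p)) = 0" by (simp only: sum.empty)
    then show ?case using C0_pos 0 p1 by (simp del: Collect_empty_eq)
  next
    case (Suc n)
    have "(\<Sum>g\<in>elems x. real (count (factorisation P g) p))
        \<le> C0 * (x / nrm p) + C0 * (x / nrm p) / (nrm p - 1)"
      unfolding sum_count_factorisation[OF p, of x]
      by (intro add_mono N_le Suc.IH) (use Suc p1 in \<open>auto simp: field_simps\<close>)
    also have "\<dots> = C0 * x / (nrm p - 1)"
      using p1 by (simp add: field_simps)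
    finally show ?case .
  qed
qed

text \<open>Prime norms may be close to 1, so \<open>t - 1\<close> is not comparable to
  \<open>t\<close>; the zero of \<open>ln t\<close> at 1 compensates, through ln t = 2 ln (sqrt t)
  \<le> 2 (sqrt t - 1).\<close>

lemma ln_div_mult_le: "t > 1 \<Longrightarrow> ln t / (t * (t - 1)) \<le> 2 / (t * sqrt t)" for t :: real
proof -
  assume t: "t > 1"
  have "ln t = 2 * ln (sqrt t)" using t by (simp add: ln_sqrt)
  also have "\<dots> \<le> 2 * (sqrt t - 1)" using t ln_le_minus_one[of "sqrt t"] by simp
  finally have "ln t * sqrt t \<le> 2 * (sqrt t - 1) * sqrt t" using t by (intro mult_right_mono) auto
  also have "\<dots> \<le> 2 * (t - 1)"
    using t real_le_rsqrt[of 1 t] by (simp add: left_diff_distrib mult.assoc)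
  finally have "ln t * sqrt t / (t * (t - 1) * sqrt t) \<le> 2 * (t - 1) / (t * (t - 1) * sqrt t)"
    using t by (intro divide_right_mono) auto
  moreover have "2 * (t - 1) / (t * (t - 1) * sqrt t) = 2 / (t * sqrt t)"
  proof -
    have "2 * d / (t * d * s) = 2 / (t * s)" if "d \<noteq> 0" for d s :: real
      using that by simp
    from this[of "t - 1" "sqrt t"] show ?thesis using t by simp
  qed
  ultimately show ?thesis using t by simp
qed

section \<open>The logarithmic sum over primes\<close>

definition T1 :: "real \<Rightarrow> real" where
  "T1 x = (\<Sum>p\<in>primes x. ln (nrm p) * N (x / nrm p))"

definition C1 :: real where "C1 = K / (1 - \<eta>) + 2 * C0 + 18 * C0 * C0"

lemma C1_pos: "C1 > 0"
proof -
  have "K / (1 - \<eta>) > 0" "C0 * C0 > 0" using C0_pos K_pos eta_less_1 by auto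
  then show ?thesis using C0_pos unfolding C1_def by linarith
qed

text \<open>\<open>T1 x\<close> keeps only the first power of each prime in Legendre's formula. The
  higher powers cost O(x), since the sum of ln p / (p (p - 1)) over the prime norms p is bounded; 18
  is the 2 of \<open>ln_div_mult_le\<close> times the 9 of
  \<open>sum_inverse_three_halves_le\<close>.\<close>

lemma T1_bound:
  assumes "x \<ge> 1"
  shows "\<bar>T1 x - A * x * ln x\<bar> \<le> C1 * x"
proof -
  let ?T = "\<Sum>g\<in>elems x. ln (nrm g)"
  let ?c = "\<lambda>p x. \<Sum>g\<in>elems x. real (count (factorisation P g) p)"
  have T: "?T - T1 x = (\<Sum>p\<in>primes x. ln (nrm p) * ?c p (x / nrm p))"
    unfolding sum_ln_nrm T1_def sum_subtractf[symmetric]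
    by (intro sum.cong refl, subst sum_count_factorisation) (auto simp: algebra_simps)
  have "?T - T1 x \<ge> 0"
    unfolding T using primeD(2) by (intro sum_nonneg mult_nonneg_nonneg) (auto simp: less_imp_le)
  moreover have "?T - T1 x \<le> 18 * C0 * C0 * x"
  proof -
    have "?T - T1 x \<le> (\<Sum>p\<in>primes x. 2 * C0 * x * (1 / (nrm p * sqrt (nrm p))))"
      unfolding T
    proof (rule sum_mono)
      fix p assume p: "p \<in> primes x"
      then have p1: "nrm p > 1" using primeD(2) by auto
      have "ln (nrm p) * ?c p (x / nrm p) \<le> ln (nrm p) * (C0 * (x / nrm p) / (nrm p - 1))"
        using p p1 assms by (intro mult_left_mono sum_count_le) auto
      also have "\<dots> = C0 * x * (ln (nrm p) / (nrm p * (nrm p - 1)))" by simp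
      also have "\<dots> \<le> C0 * x * (2 / (nrm p * sqrt (nrm p)))"
        using assms C0_pos p1 by (intro mult_left_mono ln_div_mult_le) auto
      finally show "ln (nrm p) * ?c p (x / nrm p) \<le> 2 * C0 * x * (1 / (nrm p * sqrt (nrm p)))"
        by (simp add: mult_ac)
    qed
    also have "\<dots> = 2 * C0 * x * (\<Sum>p\<in>primes x. 1 / (nrm p * sqrt (nrm p)))"
      by (simp add: sum_distrib_left)
    also have "\<dots> \<le> 2 * C0 * x * (\<Sum>p\<in>elems x. 1 / (nrm p * sqrt (nrm p)))"
      using C0_pos assms nrm_pos
      by (intro mult_left_mono sum_mono2 finite_elems) (auto simp: less_imp_le)
    also have "\<dots> \<le> 2 * C0 * x * (9 * C0)"
      using C0_pos assms by (intro mult_left_mono sum_inverse_three_halves_le) auto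
    finally show ?thesis by (simp add: mult_ac)
  qed
  ultimately show ?thesis using sum_ln_bound[OF assms] by (simp add: C1_def distrib_right)
qed

lemma T1_eq_0: "x < 1 \<Longrightarrow> T1 x = 0"
proof -
  assume "x < 1"
  then have "primes x = {}" using elems_empty by blast
  then show ?thesis unfolding T1_def by (simp only: sum.empty)
qed

text \<open>Extends the lower bound to arguments below 1, which occur when \<open>x\<close> is
  divided by high powers of \<open>c\<close> in \<open>chebyshev\<close>.\<close>

lemma T1_ge: "x > 0 \<Longrightarrow> T1 x \<ge> A * x * ln x - C1 * x"
proof (cases "x \<ge> 1")
  case False
  assume x: "x > 0"
  have "A * x * ln x \<le> 0"
    using x False A_pos by (intro mult_nonneg_nonpos) auto
  moreover have "C1 * x \<ge> 0" using x C1_pos by simp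
  ultimately show ?thesis using T1_eq_0[of x] False by simp
qed (use T1_bound[of x] in auto)

text \<open>Values of \<open>T1\<close> at different arguments can be combined prime by prime once
  they are sums over one common set.\<close>

lemma T1_eq_sum:
  assumes "z \<le> x"
  shows "T1 z = (\<Sum>p\<in>primes x. ln (nrm p) * N (z / nrm p))"
  unfolding T1_def
proof (rule sum.mono_neutral_left)
  show "\<forall>p\<in>primes x - primes z. ln (nrm p) * N (z / nrm p) = 0"
  proof
    fix p assume "p \<in> primes x - primes z"
    then have "z / nrm p < 1" using nrm_pos[of p] by (auto simp: divide_less_eq)
    then show "ln (nrm p) * N (z / nrm p) = 0" by (simp add: N_count_eq_0)
  qed
qed (use assms finite_primes_le in auto)

subsection \<open>Chebyshev's bound and Mertens' theorem\<close>

lemma geometric_weight_sum: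
  "(\<Sum>j<J. (1 - r) * r ^ j) = 1 - r ^ J" for r :: real
  by (induction J) (auto simp: algebra_simps)

text \<open>The weights form a truncated geometric distribution on j + 1, whose full mean is 1/(1 -
  r); the proof carries the exact truncated value.\<close>

lemma geometric_linear_weight_sum:
  fixes r :: real
  assumes "0 \<le> r" "r < 1"
  shows "(\<Sum>j<J. (1 - r) * r ^ j * real (Suc j)) \<le> 1 / (1 - r)"
proof -
  have "(1 - r) * (\<Sum>j<J. (1 - r) * r ^ j * real (Suc j)) = 1 - r ^ J - J * (1 - r) * r ^ J"
  proof (induction J)
    case (Suc J)
    have "(1 - r) * (\<Sum>j<Suc J. (1 - r) * r ^ j * real (Suc j))
        = 1 - r ^ J - J * (1 - r) * r ^ J + (1 - r) * ((1 - r) * r ^ J * real (Suc J))"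
      using Suc by (simp add: distrib_left)
    also have "\<dots> = 1 - r ^ Suc J - real (Suc J) * (1 - r) * r ^ Suc J"
      by (simp add: algebra_simps)
    finally show ?case .
  qed simp
  also have "\<dots> \<le> 1"
  proof -
    have "r ^ J \<ge> 0" "J * (1 - r) * r ^ J \<ge> 0" using assms by auto
    then show ?thesis by linarith
  qed
  finally show ?thesis using assms by (simp add: pos_le_divide_eq mult.commute)
qed

lemma geometric_sum_le:
  fixes s b :: real
  assumes "2 \<le> s" "b \<ge> 0"
  shows "(\<Sum>j<m. b * s ^ j) \<le> 2 * b / s * s ^ m"
proof (induction m)
  case (Suc m)
  have "(\<Sum>j<Suc m. b * s ^ j) \<le> 2 * b / s * s ^ m + b * s ^ m" using Suc by simp
  also have "\<dots> = (2 / s + 1) * (b * s ^ m)" by (simp add: algebra_simps)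
  also have "\<dots> \<le> 2 * (b * s ^ m)"
    using assms by (intro mult_right_mono) (auto simp: field_simps)
  also have "\<dots> = 2 * b / s * s ^ Suc m" using assms by simp
  finally show ?case .
qed (use assms in simp)

text \<open>
  The combination \<open>W z = N z - \<Sum>j<J. (1 - r) r^j c^(j+1) N (z / c^(j+1))\<close> has total
  weight nearly zero, so that summing it over primes cancels the term \<open>x ln x\<close> of \<open>T1\<close>,
  while the slow decay of the weights keeps it above the error terms of \<open>N\<close>.
\<close>

lemma weighted_count_ge:
  assumes r: "1 / 2 \<le> r" "r < 1" "16 * K * (1 - r) \<le> A"
    and c: "c > 1" "r * c powr (1 - \<eta>) \<ge> 2" "r * c powr (1 - \<eta>) \<ge> 4 * K / A"
    and z: "z \<ge> 1" and J: "c ^ J > z"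
  shows "min (A / 2) (1 / c) * z powr \<eta>
    \<le> N z - (\<Sum>j<J. (1 - r) * r ^ j * c ^ Suc j * N (z / c ^ Suc j))"
proof -
  \<comment> \<open>The error of \<open>N\<close> at the j-th dilation, multiplied by
    \<open>c ^ Suc j\<close>, is \<open>K * z powr \<eta> * b ^ Suc j\<close>; with the weight
    \<open>r ^ j\<close> these errors grow geometrically with ratio \<open>s\<close>.\<close>
  define b s where "b = c powr (1 - \<eta>)" and "s = r * b"
  have s: "s \<ge> 2" "s \<ge> 4 * K / A" and b: "b > 0"
    using c by (auto simp: s_def b_def)
  \<comment> \<open>\<open>m\<close> is the number of nonzero subtracted terms:
    \<open>z / c ^ Suc j\<close> is at least 1 exactly for \<open>j < m\<close>.\<close>
  have "\<exists>m. c ^ m \<le> z \<and> z < c ^ Suc m"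
  proof -
    define m where "m = (LEAST n. z < c ^ n)"
    have m: "z < c ^ m" unfolding m_def by (rule LeastI[of _ J]) (use J in auto)
    then obtain k where k: "m = Suc k" using z by (cases m) auto
    have "\<not> z < c ^ k" using not_less_Least[of k "\<lambda>n. z < c ^ n"] k m_def by auto
    then show ?thesis using m k by (intro exI[of _ k]) auto
  qed
  then obtain m where m: "c ^ m \<le> z" "z < c ^ Suc m" by blast
  have "c ^ m < c ^ J" using m J by linarith
  then have mJ: "m < J" using c by simp
  let ?t = "\<lambda>j. (1 - r) * r ^ j * c ^ Suc j * N (z / c ^ Suc j)"
  have "(\<Sum>j<J. ?t j) = (\<Sum>j<m. ?t j)"
  proof (rule sum.mono_neutral_right)
    show "\<forall>j\<in>{..<J} - {..<m}. ?t j = 0"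
    proof
      fix j assume "j \<in> {..<J} - {..<m}"
      then have "c ^ Suc m \<le> c ^ Suc j" using c by (intro power_increasing) auto
      then have "z < c ^ Suc j" using m by linarith
      then have "z / c ^ Suc j < 1" using c by (simp add: divide_less_eq)
      then show "?t j = 0" by (simp add: N_count_eq_0)
    qed
  qed (use mJ in auto)
  also have "\<dots> \<le> (\<Sum>j<m. (1 - r) * r ^ j * (A * z) + (1 - r) * K * z powr \<eta> * (b * s ^ j))"
  proof (rule sum_mono)
    fix j assume j: "j \<in> {..<m}"
    have "c ^ Suc j \<le> c ^ m" using c j by (intro power_increasing) auto
    then have 1: "z / c ^ Suc j \<ge> 1" using m c by (simp add: le_divide_eq)
    have cj: "c ^ Suc j > 0" using c by simp
    have "?t j \<le> (1 - r) * r ^ j * c ^ Suc j *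
        (A * (z / c ^ Suc j) + K * (z / c ^ Suc j) powr \<eta>)"
      using N_bound[OF 1] r c by (intro mult_left_mono) auto
    also have "\<dots> = (1 - r) * r ^ j * (A * z)
        + (1 - r) * K * r ^ j * (c ^ Suc j * (z / c ^ Suc j) powr \<eta>)"
      using cj c by (simp add: distrib_left del: power_Suc)
    also have "c ^ Suc j * (z / c ^ Suc j) powr \<eta> = z powr \<eta> * b ^ Suc j"
    proof -
      have "b ^ Suc j = (c ^ Suc j) powr (1 - \<eta>)"
        using c unfolding b_def by (simp add: powr_powr powr_realpow[symmetric] mult.commute del: power_Suc)
      also have "\<dots> = c ^ Suc j / (c ^ Suc j) powr \<eta>"
        using cj by (simp add: powr_diff del: power_Suc)
      finally show ?thesis using cj z by (simp add: powr_divide del: power_Suc)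
    qed
    finally show "?t j \<le> (1 - r) * r ^ j * (A * z) + (1 - r) * K * z powr \<eta> * (b * s ^ j)"
      by (simp add: s_def power_mult_distrib mult_ac)
  qed
  also have "\<dots> = A * z * (1 - r ^ m) + (1 - r) * K * z powr \<eta> * (\<Sum>j<m. b * s ^ j)"
    by (simp add: sum.distrib sum_distrib_left sum_distrib_right
        flip: geometric_weight_sum) (simp add: mult_ac)
  also have "\<dots> \<le> A * z * (1 - r ^ m) + (1 - r) * K * z powr \<eta> * (4 * s ^ m)"
  proof -
    have "(\<Sum>j<m. b * s ^ j) \<le> 2 * b / s * s ^ m"
      using s b by (intro geometric_sum_le) auto
    also have "2 * b / s = 2 / r" using b r by (simp add: s_def)
    also have "2 / r * s ^ m \<le> 4 * s ^ m"
      using r s by (intro mult_right_mono) (auto simp: divide_le_eq)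
    finally show ?thesis
      using r K_pos by (intro add_left_mono mult_left_mono) auto
  qed
  finally have sum_le: "(\<Sum>j<J. ?t j)
      \<le> A * z * (1 - r ^ m) + 4 * K * (1 - r) * (z powr \<eta> * s ^ m)"
    by (simp only: mult_ac)
  show ?thesis
  proof (cases "m = 0")
    \<comment> \<open>Here \<open>z < c\<close>, nothing is subtracted, and the bound rests on the
      identity element alone, \<open>N z\<close> \<ge> 1; this accounts for the constant
      \<open>1 / c\<close>.\<close>
    case True
    then have "min (A / 2) (1 / c) * z powr \<eta> \<le> 1 / c * z"
      using powr_eta_le[OF z] A_pos c by (intro mult_mono) auto
    also have "\<dots> \<le> 1" using m True c by simp
    also have "\<dots> \<le> N z" using N_count_ge_1[OF z] by simp
    finally show ?thesis using \<open>(\<Sum>j<J. ?t j) = (\<Sum>j<m. ?t j)\<close> True by simp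
  next
    case False
    \<comment> \<open>The main terms leave a surplus \<open>A * z * r ^ m\<close>, which is at least
      \<open>A * Z\<close> because \<open>c ^ m\<close> \<le> \<open>z\<close>. A quarter of
      \<open>A * Z\<close> pays for the error of \<open>N z\<close>, a quarter for the errors of the
      dilations, and half remains.\<close>
    have zs: "z powr \<eta> * s ^ m \<le> z * r ^ m"
    proof -
      have "b ^ m = (c ^ m) powr (1 - \<eta>)"
        using c unfolding b_def by (simp add: powr_powr powr_realpow[symmetric] mult.commute)
      also have "\<dots> \<le> z powr (1 - \<eta>)"
        using m c eta_less_1 by (intro powr_mono2) auto
      finally have "z powr \<eta> * s ^ m \<le> z powr \<eta> * (r ^ m * z powr (1 - \<eta>))"
        unfolding s_def power_mult_distrib using r by (intro mult_left_mono) auto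
      also have "\<dots> = z * r ^ m"
        using z by (simp add: mult.left_commute flip: powr_add)
      finally show ?thesis by (simp add: mult_ac)
    qed
    have "s ^ 1 \<le> s ^ m" using False s by (intro power_increasing) auto
    then have sm: "4 * K / A \<le> s ^ m" "1 \<le> s ^ m" using s by auto
    define Z where "Z = z powr \<eta> * s ^ m"
    have "K * z powr \<eta> \<le> A / 4 * Z"
    proof -
      have "K * z powr \<eta> = A / 4 * (z powr \<eta> * (4 * K / A))" using A_pos by simp
      also have "\<dots> \<le> A / 4 * Z"
        unfolding Z_def using sm A_pos by (intro mult_left_mono) auto
      finally show ?thesis .
    qed
    moreover have "4 * K * (1 - r) * Z \<le> A / 4 * Z"
      using r s by (intro mult_right_mono) (auto simp: Z_def)
    moreover have "A * Z \<le> A * z * r ^ m"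
      unfolding mult.assoc Z_def using zs A_pos by (intro mult_left_mono) auto
    moreover have "N z \<ge> A * z - K * z powr \<eta>" using N_bound[OF z] by linarith
    ultimately have "N z - (\<Sum>j<J. ?t j) \<ge> A / 2 * Z"
      using sum_le unfolding Z_def[symmetric] by (simp add: algebra_simps)
    moreover have "min (A / 2) (1 / c) * z powr \<eta> \<le> A / 2 * Z"
    proof -
      have "z powr \<eta> * 1 \<le> z powr \<eta> * s ^ m" using sm by (intro mult_left_mono) auto
      then show ?thesis unfolding Z_def using A_pos c by (intro mult_mono) auto
    qed
    ultimately show ?thesis by linarith
  qed
qed

text \<open>First \<open>r\<close> is moved towards 1, which damps the errors through the factor 1 -
  r; then \<open>c\<close> is taken large. As \<open>r\<close> \<ge> 1/2, the value \<open>B\<close>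
  = 4 + 8 K / A of \<open>c powr (1 - \<eta>)\<close> meets both lower bounds.\<close>

lemma weights_exist:
  obtains r c where "1 / 2 \<le> r" "r < 1" "16 * K * (1 - r) \<le> A"
    "c > 1" "r * c powr (1 - \<eta>) \<ge> 2" "r * c powr (1 - \<eta>) \<ge> 4 * K / A"
proof -
  define r where "r = max (1/2) (1 - A / (16 * K))"
  define B where "B = 4 + 8 * K / A"
  define c where "c = B powr (1 / (1 - \<eta>))"
  have r: "1 / 2 \<le> r" "r < 1" using A_pos K_pos by (auto simp: r_def)
  have "1 - r \<le> A / (16 * K)" by (auto simp: r_def)
  then have r2: "16 * K * (1 - r) \<le> A" using K_pos by (simp add: pos_le_divide_eq mult_ac)
  have B: "B > 4" using A_pos K_pos by (simp add: B_def)
  have c: "c > 1" using B eta_less_1 unfolding c_def by (intro gr_one_powr) auto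
  have "c powr (1 - \<eta>) = B" using B eta_less_1 by (simp add: c_def powr_powr)
  then have "r * c powr (1 - \<eta>) \<ge> 1 / 2 * B" using r B by simp
  moreover have "K / A > 0" using A_pos K_pos by simp
  ultimately have "r * c powr (1 - \<eta>) \<ge> 2" "r * c powr (1 - \<eta>) \<ge> 4 * K / A"
    by (simp_all add: B_def)
  then show ?thesis using that r r2 c by blast
qed

lemma chebyshev:
  obtains C where "C > 0"
    "\<And>x. x \<ge> 1 \<Longrightarrow> (\<Sum>p\<in>primes x. ln (nrm p) * (x / nrm p) powr \<eta>) \<le> C * x"
proof -
  obtain r c where r: "1 / 2 \<le> r" "r < 1" "16 * K * (1 - r) \<le> A"
    and c: "c > 1" "r * c powr (1 - \<eta>) \<ge> 2" "r * c powr (1 - \<eta>) \<ge> 4 * K / A"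
    using weights_exist by blast
  define m where "m = min (A / 2) (1 / c)"
  have m: "m > 0" using A_pos c by (auto simp: m_def)
  \<comment> \<open>\<open>A\<close> comes from the uncancelled \<open>r ^ J * ln x\<close> \<le> 1,
    \<open>2 * C1\<close> from the two-sided error of \<open>T1\<close>, and the last term from the
    shifts \<open>real (Suc j) * ln c\<close> averaged over the weights.\<close>
  define B where "B = A + 2 * C1 + A * ln c / (1 - r)"
  have "A * ln c / (1 - r) > 0" using A_pos r c by simp
  then have B: "B > 0" using A_pos C1_pos by (simp add: B_def)
  have "(\<Sum>p\<in>primes x. ln (nrm p) * (x / nrm p) powr \<eta>) \<le> B / m * x" if x: "x \<ge> 1" for x
  proof -
    let ?w = "\<lambda>j. (1 - r) * r ^ j"
    have cj: "c ^ Suc j > 0" for j using c by simp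
    \<comment> \<open>\<open>J\<close> depends on \<open>x\<close>: it must exhaust the dilations
      for every quotient \<open>x / nrm p\<close> and make the missing weight \<open>r ^ J\<close>
      harmless against \<open>ln x\<close>.\<close>
    obtain J where J: "x < c ^ J" "r ^ J * ln x \<le> 1"
    proof -
      have "(\<lambda>n. r ^ n * ln x) \<longlonglongrightarrow> 0 * ln x"
        using r by (intro tendsto_intros LIMSEQ_realpow_zero) auto
      then have "eventually (\<lambda>n. r ^ n * ln x < 1) sequentially"
        by (rule order_tendstoD) auto
      moreover have "eventually (\<lambda>n. x < c ^ n) sequentially"
      proof -
        obtain n where n: "x < c ^ n" using real_arch_pow c by blast
        have "x < c ^ k" if "k \<ge> n" for k
        proof -
          have "c ^ n \<le> c ^ k" using that c by (intro power_increasing) auto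
          then show ?thesis using n by linarith
        qed
        then show ?thesis by (auto simp: eventually_sequentially)
      qed
      ultimately have "eventually (\<lambda>n. r ^ n * ln x < 1 \<and> x < c ^ n) sequentially"
        by (rule eventually_conj)
      then obtain n where "r ^ n * ln x < 1 \<and> x < c ^ n"
        by (auto simp: eventually_sequentially)
      then show ?thesis using that by auto
    qed
    have "m * (\<Sum>p\<in>primes x. ln (nrm p) * (x / nrm p) powr \<eta>)
        \<le> (\<Sum>p\<in>primes x. ln (nrm p) * (N (x / nrm p)
            - (\<Sum>j<J. ?w j * c ^ Suc j * N (x / nrm p / c ^ Suc j))))"
      unfolding sum_distrib_left
    proof (rule sum_mono)
      fix p assume p: "p \<in> primes x"
      then have p1: "nrm p > 1" using primeD by auto
      have "x / nrm p \<le> x" using p1 x by (simp add: divide_le_eq)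
      then have "m * (x / nrm p) powr \<eta> \<le> N (x / nrm p)
            - (\<Sum>j<J. ?w j * c ^ Suc j * N (x / nrm p / c ^ Suc j))"
        unfolding m_def using p p1 J r c by (intro weighted_count_ge) auto
      then have "ln (nrm p) * (m * (x / nrm p) powr \<eta>) \<le> ln (nrm p) * (N (x / nrm p)
            - (\<Sum>j<J. ?w j * c ^ Suc j * N (x / nrm p / c ^ Suc j)))"
        using p1 by (intro mult_left_mono) auto
      then show "m * (ln (nrm p) * (x / nrm p) powr \<eta>) \<le> ln (nrm p) * (N (x / nrm p)
            - (\<Sum>j<J. ?w j * c ^ Suc j * N (x / nrm p / c ^ Suc j)))"
        by (simp only: mult.left_commute)
    qed
    also have "\<dots> = T1 x - (\<Sum>j<J. ?w j * c ^ Suc j * T1 (x / c ^ Suc j))"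
    proof -
      have "T1 (x / c ^ Suc j) = (\<Sum>p\<in>primes x. ln (nrm p) * N (x / nrm p / c ^ Suc j))" for j
      proof -
        have "c ^ Suc j \<ge> 1" using c by (intro one_le_power) auto
        then have "x / c ^ Suc j \<le> x" using cj[of j] x by (simp add: divide_le_eq del: power_Suc)
        from T1_eq_sum[OF this] show ?thesis by (simp add: mult.commute)
      qed
      then have "(\<Sum>j<J. ?w j * c ^ Suc j * T1 (x / c ^ Suc j))
        = (\<Sum>j<J. \<Sum>p\<in>primes x. ln (nrm p) * (?w j * c ^ Suc j * N (x / nrm p / c ^ Suc j)))"
        by (simp add: sum_distrib_left mult_ac del: power_Suc)
      also have "\<dots> = (\<Sum>p\<in>primes x. \<Sum>j<J. ln (nrm p) * (?w j * c ^ Suc j * N (x / nrm p / c ^ Suc j)))"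
        by (rule sum.swap)
      finally show ?thesis
        by (simp add: T1_def right_diff_distrib sum_subtractf sum_distrib_left del: power_Suc)
    qed
    \<comment> \<open>Rescaled by \<open>c ^ Suc j\<close>, the lower bound for
      \<open>T1 (x / c ^ Suc j)\<close> reproduces \<open>A * x * ln x\<close> up to a shift; total
      weight \<open>1 - r ^ J\<close> then cancels nearly all of the leading term.\<close>
    also have "\<dots> \<le> A * x * ln x + C1 * x
        - (\<Sum>j<J. ?w j * (A * x * ln x - C1 * x) - A * x * ln c * (?w j * real (Suc j)))"
    proof (intro diff_mono sum_mono)
      show "T1 x \<le> A * x * ln x + C1 * x" using T1_bound[OF x] by linarith
      fix j
      have "?w j * (A * x * ln x - C1 * x) - A * x * ln c * (?w j * real (Suc j))
        = ?w j * c ^ Suc j * (A * (x / c ^ Suc j) * ln (x / c ^ Suc j) - C1 * (x / c ^ Suc j))"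
      proof -
        have "ln (x / c ^ Suc j) = ln x - real (Suc j) * ln c"
          using x c cj[of j] by (simp add: ln_div ln_realpow del: power_Suc)
        then show ?thesis using cj[of j] c
          by (simp add: right_diff_distrib diff_divide_distrib mult_ac del: power_Suc of_nat_Suc)
      qed
      also have "\<dots> \<le> ?w j * c ^ Suc j * T1 (x / c ^ Suc j)"
        using r c x cj by (intro mult_left_mono T1_ge) auto
      finally show "?w j * (A * x * ln x - C1 * x) - A * x * ln c * (?w j * real (Suc j))
        \<le> ?w j * c ^ Suc j * T1 (x / c ^ Suc j)" .
    qed
    also have "\<dots> = A * x * ln x + C1 * x - (1 - r ^ J) * (A * x * ln x - C1 * x)
        + A * x * ln c * (\<Sum>j<J. ?w j * real (Suc j))"
      by (simp only: sum_subtractf geometric_weight_sum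
          flip: sum_distrib_right[of _ _ "A * x * ln x - C1 * x"] sum_distrib_left[of "A * x * ln c"])
    also have "\<dots> = A * x * (r ^ J * ln x) + C1 * x + (1 - r ^ J) * (C1 * x)
        + A * x * ln c * (\<Sum>j<J. ?w j * real (Suc j))"
      by (simp add: algebra_simps)
    also have "\<dots> \<le> A * x * 1 + C1 * x + 1 * (C1 * x) + A * x * ln c * (1 / (1 - r))"
      using A_pos C1_pos x J r c
      by (intro add_mono mult_left_mono mult_right_mono geometric_linear_weight_sum) auto
    also have "\<dots> = B * x" by (simp add: B_def algebra_simps)
    finally show ?thesis using m by (simp add: pos_le_divide_eq mult.commute)
  qed
  then show ?thesis using that[of "B / m"] m B by simp
qed

definition C2 :: real where
  "C2 = (SOME C. C > 0 \<and>
    (\<forall>x\<ge>1. (\<Sum>p\<in>primes x. ln (nrm p) * (x / nrm p) powr \<eta>) \<le> C * x))"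

lemma C2: "C2 > 0"
  "x \<ge> 1 \<Longrightarrow> (\<Sum>p\<in>primes x. ln (nrm p) * (x / nrm p) powr \<eta>) \<le> C2 * x"
proof -
  have "\<exists>C>0. \<forall>x\<ge>1. (\<Sum>p\<in>primes x. ln (nrm p) * (x / nrm p) powr \<eta>) \<le> C * x"
    using chebyshev by metis
  from someI_ex[OF this] show "C2 > 0"
    "x \<ge> 1 \<Longrightarrow> (\<Sum>p\<in>primes x. ln (nrm p) * (x / nrm p) powr \<eta>) \<le> C2 * x"
    unfolding C2_def by blast+
qed

definition M0 :: real where "M0 = (C1 + K * C2) / A"

lemma M0_pos: "M0 > 0"
  using A_pos C1_pos K_pos C2(1) by (simp add: M0_def add_pos_pos)

text \<open>In \<open>T1 x\<close>, replacing \<open>N (x / nrm p)\<close> by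
  \<open>A * (x / nrm p)\<close> costs O(x) in total by the weighted Chebyshev bound; dividing by
  \<open>A * x\<close> leaves O(1).\<close>

lemma mertens:
  assumes x: "x \<ge> 1"
  shows "\<bar>(\<Sum>p\<in>primes x. ln (nrm p) / nrm p) - ln x\<bar> \<le> M0"
proof -
  let ?M = "\<Sum>p\<in>primes x. ln (nrm p) / nrm p"
  have "T1 x - A * x * ?M = (\<Sum>p\<in>primes x. ln (nrm p) * (N (x / nrm p) - A * (x / nrm p)))"
    by (simp add: T1_def sum_distrib_left right_diff_distrib sum_subtractf mult_ac)
  also have "\<bar>\<dots>\<bar> \<le> (\<Sum>p\<in>primes x. K * (ln (nrm p) * (x / nrm p) powr \<eta>))"
  proof (rule order_trans[OF sum_abs sum_mono])
    fix p assume p: "p \<in> primes x"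
    then have p1: "nrm p > 1" using primeD by auto
    then have "ln (nrm p) * \<bar>N (x / nrm p) - A * (x / nrm p)\<bar>
        \<le> ln (nrm p) * (K * (x / nrm p) powr \<eta>)"
      using p by (intro mult_left_mono N_bound) auto
    then show "\<bar>ln (nrm p) * (N (x / nrm p) - A * (x / nrm p))\<bar>
        \<le> K * (ln (nrm p) * (x / nrm p) powr \<eta>)"
      using p1 by (simp add: abs_mult mult_ac)
  qed
  also have "\<dots> \<le> K * (C2 * x)"
    unfolding sum_distrib_left[symmetric] using K_pos C2(2)[OF x] by (intro mult_left_mono) auto
  finally have "\<bar>A * x * ?M - A * x * ln x\<bar> \<le> K * (C2 * x) + C1 * x"
    using T1_bound[OF x] by linarith
  also have "A * x * ?M - A * x * ln x = A * x * (?M - ln x)" by (simp add: algebra_simps)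
  finally have "x * (A * \<bar>?M - ln x\<bar>) \<le> x * (C1 + K * C2)"
    using A_pos x unfolding abs_mult by (simp add: distrib_left mult_ac)
  then have "A * \<bar>?M - ln x\<bar> \<le> C1 + K * C2" using x by simp
  then show ?thesis using A_pos by (simp add: M0_def pos_le_divide_eq mult.commute)
qed

end

subsection \<open>The Dickman function\<close>

text \<open>
  Summation by parts for a Lipschitz function, without integrals: the defect \<open>Q\<close> below
  changes by \<open>O(t' - t)\<close> over steps of length at most \<open>1\<close>.
\<close>

lemma weighted_sum_lipschitz:
  fixes w s :: "'b \<Rightarrow> real" and f H :: "real \<Rightarrow> real"
  assumes S: "finite S" and w: "\<And>p. p \<in> S \<Longrightarrow> w p \<ge> 0"
    and M: "\<And>t. a \<le> t \<Longrightarrow> t \<le> L \<Longrightarrow> \<bar>(\<Sum>p | p \<in> S \<and> s p \<le> t. w p) - t\<bar> \<le> C"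
    and f: "\<And>t t'. a \<le> t \<Longrightarrow> t \<le> t' \<Longrightarrow> t' \<le> L \<Longrightarrow> \<bar>f t' - f t\<bar> \<le> B * (t' - t)"
    and H_cont: "continuous_on {a..L} H"
    and H_deriv: "\<And>t. a < t \<Longrightarrow> t < L \<Longrightarrow> (H has_real_derivative f t) (at t)"
    and aL: "a \<le> L" and B: "B \<ge> 0"
  shows "\<bar>(\<Sum>p | p \<in> S \<and> a < s p \<and> s p \<le> L. w p * f (s p)) - (H L - H a)\<bar>
    \<le> 2 * C * \<bar>f L\<bar> + B * (4 * C + 2) * (L - a)"
proof -
  define M where "M t = (\<Sum>p | p \<in> S \<and> s p \<le> t. w p)" for t
  define F where "F t = (\<Sum>p | p \<in> S \<and> a < s p \<and> s p \<le> t. w p * f (s p))" for t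
  define D where "D t = M t - M a - (t - a)" for t
  \<comment> \<open>Formally \<open>F t - (H t - H a)\<close> is the integral of f dD. Taking out
    the boundary term \<open>f t * D t\<close> leaves minus the integral of D df, which is O(t - a)
    for bounded \<open>D\<close> and Lipschitz \<open>f\<close>.\<close>
  define Q where "Q t = F t - (H t - H a) - f t * D t" for t
  have M': "\<bar>M t - t\<bar> \<le> C" if "a \<le> t" "t \<le> L" for t using M that by (simp add: M_def)
  have C: "C \<ge> 0" using M'[of a] aL by linarith
  have D: "\<bar>D t\<bar> \<le> 2 * C" if "a \<le> t" "t \<le> L" for t
    using M'[OF that] M'[of a] aL unfolding D_def by linarith
  \<comment> \<open>The increment is bounded by B (t' - t) (2 (t' - t) + 4 C); steps of length at
    most 1 make this linear in t' - t, so that it adds up along a chain.\<close>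
  have step: "\<bar>Q t' - Q t\<bar> \<le> B * (4 * C + 2) * (t' - t)"
    if t: "a \<le> t" "t \<le> t'" "t' \<le> L" "t' - t \<le> 1" for t t'
  proof -
    let ?I = "{p. p \<in> S \<and> t < s p \<and> s p \<le> t'}"
    have "{p. p \<in> S \<and> s p \<le> t'} = {p. p \<in> S \<and> s p \<le> t} \<union> ?I" using t by auto
    then have MI: "M t' = M t + (\<Sum>p\<in>?I. w p)"
      unfolding M_def using S by (simp add: sum.union_disjoint Int_def)
    have "{p. p \<in> S \<and> a < s p \<and> s p \<le> t'} = {p. p \<in> S \<and> a < s p \<and> s p \<le> t} \<union> ?I"
      using t by auto
    then have FI: "F t' = F t + (\<Sum>p\<in>?I. w p * f (s p))"
      unfolding F_def using S by (simp add: sum.union_disjoint Int_def)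
    have "(\<Sum>p\<in>?I. w p * f (s p)) = (\<Sum>p\<in>?I. w p * (f (s p) - f t')) + f t' * (\<Sum>p\<in>?I. w p)"
      by (simp add: sum_distrib_left algebra_simps flip: sum.distrib)
    then have Q: "Q t' - Q t = (\<Sum>p\<in>?I. w p * (f (s p) - f t'))
        - (H t' - H t - f t' * (t' - t)) - (f t' - f t) * D t"
      using MI FI by (simp add: Q_def D_def algebra_simps)
    have 1: "\<bar>\<Sum>p\<in>?I. w p * (f (s p) - f t')\<bar> \<le> B * (t' - t) * (t' - t + 2 * C)"
    proof -
      have "\<bar>\<Sum>p\<in>?I. w p * (f (s p) - f t')\<bar> \<le> (\<Sum>p\<in>?I. B * (t' - t) * w p)"
      proof (rule order_trans[OF sum_abs sum_mono])
        fix p assume p: "p \<in> ?I"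
        have "\<bar>f t' - f (s p)\<bar> \<le> B * (t' - s p)" using p t by (intro f) auto
        also have "\<dots> \<le> B * (t' - t)" using p B by (intro mult_left_mono) auto
        finally have "w p * \<bar>f (s p) - f t'\<bar> \<le> w p * (B * (t' - t))"
          using w[of p] p by (intro mult_left_mono) (auto simp: abs_minus_commute)
        then show "\<bar>w p * (f (s p) - f t')\<bar> \<le> B * (t' - t) * w p"
          using w[of p] p by (simp add: abs_mult mult_ac)
      qed
      also have "\<dots> = B * (t' - t) * (M t' - M t)" by (simp add: MI sum_distrib_left)
      also have "\<dots> \<le> B * (t' - t) * (t' - t + 2 * C)"
        using B t M'[of t] M'[of t'] by (intro mult_left_mono) auto
      finally show ?thesis .
    qed
    have 2: "\<bar>H t' - H t - f t' * (t' - t)\<bar> \<le> B * (t' - t) * (t' - t)"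
    proof (cases "t = t'")
      case False
      then have tt: "t < t'" using t by simp
      have "\<exists>z. t < z \<and> z < t' \<and> H t' - H t = (t' - t) * f z"
      proof -
        have "continuous_on {t..t'} H" by (rule continuous_on_subset[OF H_cont]) (use t in auto)
        moreover have "(H has_real_derivative f z) (at z)" if "t < z" "z < t'" for z
          using that t by (intro H_deriv) auto
        ultimately obtain l z where "t < z" "z < t'" "(H has_real_derivative l) (at z)"
          "H t' - H t = (t' - t) * l"
          using MVT[of t t' H] tt by (meson real_differentiable_def)
        moreover from this have "l = f z" using t H_deriv[of z] DERIV_unique by force
        ultimately show ?thesis by blast
      qed
      then obtain z where z: "t < z" "z < t'" "H t' - H t = (t' - t) * f z" by blast
      have "H t' - H t - f t' * (t' - t) = (t' - t) * (f z - f t')"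
        using z by (simp add: algebra_simps)
      then have "\<bar>H t' - H t - f t' * (t' - t)\<bar> = (t' - t) * \<bar>f t' - f z\<bar>"
        using t by (simp add: abs_mult abs_minus_commute)
      also have "\<dots> \<le> (t' - t) * (B * (t' - t))"
      proof -
        have "\<bar>f t' - f z\<bar> \<le> B * (t' - z)" using z t by (intro f) auto
        also have "\<dots> \<le> B * (t' - t)" using z B by (intro mult_left_mono) auto
        finally show ?thesis using t by (intro mult_left_mono) auto
      qed
      finally show ?thesis by (simp add: mult_ac)
    qed simp
    have 3: "\<bar>(f t' - f t) * D t\<bar> \<le> B * (t' - t) * (2 * C)"
      unfolding abs_mult using f[of t t'] D[of t] t B by (intro mult_mono) auto
    have "\<bar>Q t' - Q t\<bar> \<le> B * (t' - t) * (t' - t + 2 * C) + B * (t' - t) * (t' - t) + B * (t' - t) * (2 * C)"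
      using 1 2 3 unfolding Q by linarith
    also have "\<dots> = B * (t' - t) * (2 * (t' - t) + 4 * C)" by (simp add: algebra_simps)
    also have "\<dots> \<le> B * (t' - t) * (2 * 1 + 4 * C)"
      using B t by (intro mult_left_mono add_right_mono) auto
    finally show ?thesis by (simp add: mult_ac add_ac)
  qed
  have chain: "\<bar>Q t - Q a\<bar> \<le> B * (4 * C + 2) * (t - a)"
    if "a \<le> t" "t \<le> L" "t - a \<le> real n" for n t
    using that
  proof (induction n arbitrary: t)
    case (Suc n)
    define u where "u = max a (t - 1)"
    have "\<bar>Q u - Q a\<bar> \<le> B * (4 * C + 2) * (u - a)"
      using Suc by (intro Suc.IH) (auto simp: u_def)
    moreover have "\<bar>Q t - Q u\<bar> \<le> B * (4 * C + 2) * (t - u)"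
      using Suc by (intro step) (auto simp: u_def)
    ultimately show ?case by (simp add: algebra_simps)
  qed simp
  obtain n where "L - a \<le> real n" using real_arch_simple by blast
  then have "\<bar>Q L - Q a\<bar> \<le> B * (4 * C + 2) * (L - a)" using chain aL by blast
  moreover have "F a = 0" unfolding F_def by (rule sum.neutral) auto
  then have "Q a = 0" by (simp add: Q_def D_def)
  moreover have "\<bar>f L * D L\<bar> \<le> 2 * C * \<bar>f L\<bar>"
    using mult_left_mono[OF D[of L], of "\<bar>f L\<bar>"] aL by (simp add: abs_mult mult_ac)
  moreover have "F L - (H L - H a) = Q L + f L * D L" by (simp add: Q_def)
  ultimately show ?thesis unfolding F_def by linarith
qed

lemma dickman_eq_1: "0 \<le> u \<Longrightarrow> u \<le> 1 \<Longrightarrow> dickman u = 1"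
  using dickman(1) by (simp add: is_dickman_def)

lemma continuous_on_dickman: "continuous_on {0..} dickman"
  using dickman(1) by (simp add: is_dickman_def)

lemma DERIV_dickman:
  assumes "u > 1"
  shows "(dickman has_real_derivative - dickman (u - 1) / u) (at u)"
proof -
  have "dickman differentiable (at u)" and eq: "u * deriv dickman u + dickman (u - 1) = 0"
    using dickman(1) assms by (auto simp: is_dickman_def)
  then have "(dickman has_real_derivative deriv dickman u) (at u)"
    by (simp add: DERIV_deriv_iff_real_differentiable)
  moreover have "deriv dickman u = - dickman (u - 1) / u"
    using eq assms by (simp add: field_simps)
  ultimately show ?thesis by simp
qed

lemma dickman_bounded: "\<exists>R\<ge>1. \<forall>u\<in>{0..U}. \<bar>dickman u\<bar> \<le> R"
proof -
  have "continuous_on {0..U} dickman"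
    by (rule continuous_on_subset[OF continuous_on_dickman]) auto
  then have "compact (dickman ` {0..U})" by (intro compact_continuous_image) auto
  then obtain R where "\<forall>u\<in>{0..U}. \<bar>dickman u\<bar> \<le> R"
    by (auto dest!: compact_imp_bounded simp: bounded_iff)
  then show ?thesis by (intro exI[of _ "max 1 R"]) force
qed

lemma dickman_lipschitz:
  assumes R: "\<forall>u\<in>{0..U}. \<bar>dickman u\<bar> \<le> R" and uv: "0 \<le> u" "u \<le> v" "v \<le> U"
  shows "\<bar>dickman v - dickman u\<bar> \<le> R * (v - u)"
proof (cases "v \<le> 1 \<or> u = v")
  case True
  have "R \<ge> 0" using R uv by force
  then show ?thesis using True uv by (auto simp: dickman_eq_1)
next
  case False
  \<comment> \<open>\<open>dickman\<close> has a corner at 1 and is constant before it, so the mean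
    value theorem starts at \<open>max 1 u\<close>, where the value is the same.\<close>
  define u' where "u' = max 1 u"
  have u': "u' \<ge> 1" "u' < v" "u \<le> u'" using False uv by (auto simp: u'_def)
  have "continuous_on {u'..v} dickman"
    by (rule continuous_on_subset[OF continuous_on_dickman]) (use u' in auto)
  moreover have "dickman differentiable (at z)" if "u' < z" for z
    unfolding real_differentiable_def using DERIV_dickman[of z] u' that by auto
  ultimately obtain l z where z: "u' < z" "z < v" "(dickman has_real_derivative l) (at z)"
    "dickman v - dickman u' = (v - u') * l"
    using MVT[of u' v dickman] u' by blast
  then have l: "l = - dickman (z - 1) / z" using DERIV_unique[OF z(3) DERIV_dickman] u' by auto
  have "\<bar>dickman (z - 1)\<bar> \<le> R" using R z u' uv by auto
  then have "\<bar>dickman (z - 1)\<bar> / z \<le> R / 1" using z u' by (intro frac_le) auto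
  then have "\<bar>l\<bar> \<le> R / 1" unfolding l using z u' by simp
  have "dickman u' = dickman u" using uv by (simp add: u'_def max_def dickman_eq_1)
  then have "\<bar>dickman v - dickman u\<bar> = (v - u') * \<bar>l\<bar>" using z u' by (simp add: abs_mult)
  also have "\<dots> \<le> (v - u) * R" using \<open>\<bar>l\<bar> \<le> R / 1\<close> u' by (intro mult_mono) auto
  finally show ?thesis by (simp add: mult_ac)
qed

text \<open>The summand has antiderivative \<open>dickman (L / t)\<close>. Since \<open>a\<close>
  \<ge> L/U, its Lipschitz constant is at most 2 R U^3 / L^2, so partial summation over a length of
  at most \<open>L\<close> loses O(1/L).\<close>

lemma dickman_weighted_sum:
  fixes w s :: "'b \<Rightarrow> real"
  assumes S: "finite S" and w: "\<And>p. p \<in> S \<Longrightarrow> w p \<ge> 0"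
    and M: "\<And>t. a \<le> t \<Longrightarrow> t \<le> L \<Longrightarrow> \<bar>(\<Sum>p | p \<in> S \<and> s p \<le> t. w p) - t\<bar> \<le> C"
    and a: "0 < a" "a \<le> L" "L / a \<le> U"
    and R: "R \<ge> 0" "\<forall>u\<in>{0..U}. \<bar>dickman u\<bar> \<le> R"
  shows "\<bar>(\<Sum>p | p \<in> S \<and> a < s p \<and> s p \<le> L. w p * (dickman (L / s p - 1) / s p))
      - (1 - dickman (L / a))\<bar> \<le> (2 * C + 2 * R * U ^ 3 * (4 * C + 2)) / L"
proof -
  define f where "f t = dickman (L / t - 1) / t" for t
  \<comment> \<open>The first term bounds the variation of \<open>dickman (L / t - 1)\<close>, the
    second that of the factor \<open>1 / t\<close>.\<close>
  define B where "B = R * (L / a ^ 3 + 1 / a ^ 2)"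
  have L: "L > 0" using a by simp
  have B0: "B \<ge> 0" using R a L by (simp add: B_def)
  have U: "U \<ge> 1" using a by (simp add: pos_divide_le_eq) (smt (verit) a(3) le_divide_eq_1_pos)
  have range: "L / t - 1 \<in> {0..U}" if "a \<le> t" "t \<le> L" for t
  proof -
    have "L / t \<le> L / a" using that a by (intro divide_left_mono) auto
    then have "L / t \<le> U" using a by linarith
    moreover have "L / t \<ge> 1" using that a by simp
    ultimately show ?thesis by simp
  qed
  have f: "\<bar>f t' - f t\<bar> \<le> B * (t' - t)" if t: "a \<le> t" "t \<le> t'" "t' \<le> L" for t t'
  proof -
    have pos: "t > 0" "t' > 0" using t a by auto
    have d: "1 / t - 1 / t' = (t' - t) / (t * t')" using pos by (simp add: field_simps)
    have le: "(t' - t) / (t * t') \<le> (t' - t) / (a * a)"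
      using t a by (intro divide_left_mono mult_mono) auto
    have "f t' - f t = (dickman (L / t' - 1) - dickman (L / t - 1)) / t'
        - dickman (L / t - 1) * (1 / t - 1 / t')"
      using pos by (simp add: f_def field_simps)
    also have "\<bar>\<dots>\<bar> \<le> \<bar>(dickman (L / t' - 1) - dickman (L / t - 1)) / t'\<bar>
        + \<bar>dickman (L / t - 1) * (1 / t - 1 / t')\<bar>" by (rule abs_triangle_ineq4)
    also have "\<dots> \<le> R * (L * ((t' - t) / (a * a))) / a + R * ((t' - t) / (a * a))"
    proof (rule add_mono)
      have "L / t' \<le> L / t" using t pos L by (intro divide_left_mono) auto
      then have "\<bar>dickman (L / t - 1) - dickman (L / t' - 1)\<bar> \<le> R * ((L / t - 1) - (L / t' - 1))"
        using range[of t] range[of t'] t by (intro dickman_lipschitz[OF R(2)]) auto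
      also have "(L / t - 1) - (L / t' - 1) = L * (1 / t - 1 / t')" by (simp add: algebra_simps)
      also have "R * \<dots> \<le> R * (L * ((t' - t) / (a * a)))"
        unfolding d using le R L by (intro mult_left_mono) auto
      finally have "\<bar>dickman (L / t' - 1) - dickman (L / t - 1)\<bar> / t'
          \<le> R * (L * ((t' - t) / (a * a))) / a"
        using t a by (intro frac_le) (auto simp: abs_minus_commute)
      then show "\<bar>(dickman (L / t' - 1) - dickman (L / t - 1)) / t'\<bar>
          \<le> R * (L * ((t' - t) / (a * a))) / a" using pos by simp
      have "(t' - t) / (t * t') \<ge> 0" using t pos by simp
      then have "\<bar>dickman (L / t - 1) * (1 / t - 1 / t')\<bar>
          = \<bar>dickman (L / t - 1)\<bar> * ((t' - t) / (t * t'))" unfolding d by (simp only: abs_mult abs_of_nonneg)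
      also have "\<dots> \<le> R * ((t' - t) / (a * a))"
        using R range[of t] t le pos by (intro mult_mono) auto
      finally show "\<bar>dickman (L / t - 1) * (1 / t - 1 / t')\<bar> \<le> R * ((t' - t) / (a * a))" .
    qed
    also have "\<dots> = B * (t' - t)"
      using a by (simp add: B_def power2_eq_square power3_eq_cube algebra_simps)
    finally show ?thesis .
  qed
  have cont: "continuous_on {a..L} (\<lambda>t. dickman (L / t))"
    using a by (intro continuous_on_compose2[OF continuous_on_dickman] continuous_intros) auto
  have deriv: "((\<lambda>t. dickman (L / t)) has_real_derivative f t) (at t)" if t: "a < t" "t < L" for t
  proof -
    have "((\<lambda>t. L / t) has_real_derivative - L / t ^ 2) (at t)"
      using t a by (auto intro!: derivative_eq_intros simp: power2_eq_square)
    from DERIV_chain2[OF DERIV_dickman this]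
    have "((\<lambda>t. dickman (L / t)) has_real_derivative - dickman (L / t - 1) / (L / t) * (- L / t ^ 2)) (at t)"
      using t a by (simp add: less_divide_eq)
    also have "- dickman (L / t - 1) / (L / t) * (- L / t ^ 2) = f t"
      using t a by (simp add: f_def power2_eq_square)
    finally show ?thesis .
  qed
  have "\<bar>(\<Sum>p | p \<in> S \<and> a < s p \<and> s p \<le> L. w p * f (s p)) - (dickman (L / L) - dickman (L / a))\<bar>
      \<le> 2 * C * \<bar>f L\<bar> + B * (4 * C + 2) * (L - a)"
    by (rule weighted_sum_lipschitz[OF S w M f cont deriv a(2) B0])
  also have "\<dots> \<le> 2 * C * (1 / L) + 2 * R * U ^ 3 / L ^ 2 * (4 * C + 2) * L"
  proof -
    have C: "C \<ge> 0" using M[of a] a by force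
    have aU: "1 / a \<le> U / L" using a L by (simp add: field_simps)
    have "L / a ^ 3 = L * (1 / a) ^ 3" by (simp add: power_one_over)
    also have "\<dots> \<le> L * (U / L) ^ 3" using aU a L by (intro mult_left_mono power_mono) auto
    also have "\<dots> = U ^ 3 / L ^ 2" using L by (simp add: power_divide power2_eq_square power3_eq_cube)
    finally have "L / a ^ 3 \<le> U ^ 3 / L ^ 2" .
    moreover have "1 / a ^ 2 \<le> U ^ 3 / L ^ 2"
    proof -
      have "1 / a ^ 2 = (1 / a) ^ 2" by (simp add: power_one_over)
      also have "\<dots> \<le> (U / L) ^ 2" using aU a by (intro power_mono) auto
      also have "\<dots> = U ^ 2 / L ^ 2" by (simp add: power_divide)
      also have "\<dots> \<le> U ^ 3 / L ^ 2" using U by (intro divide_right_mono power_increasing) auto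
      finally show ?thesis .
    qed
    ultimately have "B \<le> R * (2 * (U ^ 3 / L ^ 2))"
      unfolding B_def using R by (intro mult_left_mono) auto
    then have "B \<le> 2 * R * U ^ 3 / L ^ 2" by (simp add: mult_ac)
    moreover have "\<bar>f L\<bar> = 1 / L" using L by (simp add: f_def dickman_eq_1)
    ultimately show ?thesis using C a R U L B0 by (intro add_mono mult_mono) auto
  qed
  also have "\<dots> = (2 * C + 2 * R * U ^ 3 * (4 * C + 2)) / L"
    using L by (simp add: power2_eq_square field_simps)
  also have "dickman (L / L) = 1" using L by (simp add: dickman_eq_1)
  finally show ?thesis by (simp add: f_def)
qed

subsection \<open>Buchstab's identity\<close>

context arithmetic_semigroup
begin

lemma smooth_prime_mult:
  "p \<in> P \<Longrightarrow> smooth P nrm y (p * h) \<longleftrightarrow> nrm p \<le> y \<and> smooth P nrm y h"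
  by (auto simp: smooth_def factorisation_mult factorisation_prime)

lemma finite_smooth: "finite {g. smooth P nrm y g \<and> nrm g \<le> x}"
  by (rule finite_subset[OF _ finite_elems[of x]]) auto

lemma Psi_eq_N_count: "x \<le> y \<Longrightarrow> Psi P nrm x y = N_count nrm x"
proof -
  assume "x \<le> y"
  then have "smooth P nrm y g" if "nrm g \<le> x" for g
    using nrm_le_of_mem_factorisation[of _ g] that by (force simp: smooth_def)
  then show ?thesis unfolding Psi_def N_count_def by (intro arg_cong[of _ _ card]) auto
qed

text \<open>
  Distinct primes may share a norm, so an element can have several prime factors of maximal
  norm; Buchstab's identity then counts it repeatedly. The right-hand side bounds the excess.
\<close>

lemma buchstab:
  "\<bar>real (N_count nrm x) - real (Psi P nrm x y)
      - (\<Sum>p | p \<in> P \<and> y < nrm p \<and> nrm p \<le> x. real (Psi P nrm (x / nrm p) (nrm p)))\<bar>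
    \<le> (\<Sum>p | p \<in> P \<and> y < nrm p \<and> nrm p \<le> x.
          real (card {q \<in> P. nrm q = nrm p}) * real (N_count nrm (x / nrm p ^ 2)))"
proof -
  let ?I = "{p. p \<in> P \<and> y < nrm p \<and> nrm p \<le> x}"
  let ?h = "\<lambda>p. {h. smooth P nrm (nrm p) h \<and> nrm h \<le> x / nrm p}"
  let ?q = "\<lambda>p. {q \<in> P. nrm q = nrm p}"
  \<comment> \<open>Pairs in \<open>D\<close> single out a prime factor of maximal norm, and
    \<open>m\<close> maps them onto the non-smooth elements \<open>B\<close>. Outside
    \<open>E\<close>, where no other prime attains that norm, \<open>m\<close> is injective, so card
    D - card E \<le> card B \<le> card D. Repetitions of \<open>p\<close> itself give a single
    pair.\<close>
  define D where "D = Sigma ?I ?h"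
  define E where "E = {(p, h) \<in> D. \<exists>q\<in>P. q \<noteq> p \<and> nrm q = nrm p \<and> q \<in># factorisation P h}"
  define m :: "'a \<times> 'a \<Rightarrow> 'a" where "m = (\<lambda>(p, h). p * h)"
  define B where "B = {g. nrm g \<le> x \<and> \<not> smooth P nrm y g}"
  have I: "finite ?I" by (rule finite_subset[OF _ finite_elems[of x]]) auto
  have finD: "finite D" unfolding D_def using I finite_smooth by (intro finite_SigmaI) auto
  have finB: "finite B" unfolding B_def by (rule finite_subset[OF _ finite_elems[of x]]) auto
  have cardD: "real (card D) = (\<Sum>p\<in>?I. real (Psi P nrm (x / nrm p) (nrm p)))"
    unfolding D_def Psi_def using I finite_smooth by (subst card_SigmaI) auto
  have cardB: "real (N_count nrm x) - real (Psi P nrm x y) = real (card B)"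
  proof -
    have "{g. nrm g \<le> x} = {g. smooth P nrm y g \<and> nrm g \<le> x} \<union> B" by (auto simp: B_def)
    then have "N_count nrm x = Psi P nrm x y + card B"
      unfolding N_count_def Psi_def
      by (simp only:) (intro card_Un_disjoint finite_smooth finB, auto simp: B_def)
    then show ?thesis by simp
  qed
  have image: "m ` D = B"
  proof (intro set_eqI iffI)
    fix g assume "g \<in> m ` D"
    then show "g \<in> B"
      using nrm_pos by (auto simp: m_def D_def B_def smooth_prime_mult nrm_mult field_simps)
  next
    fix g assume g: "g \<in> B"
    let ?F = "set_mset (factorisation P g)"
    obtain p0 where p0: "p0 \<in> ?F" "y < nrm p0" using g by (auto simp: B_def smooth_def not_le)
    have "Max (nrm ` ?F) \<in> nrm ` ?F" using p0 by (intro Max_in) auto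
    then obtain p where p: "p \<in> ?F" "Max (nrm ` ?F) = nrm p" by auto
    have max: "nrm q \<le> nrm p" if "q \<in> ?F" for q
      unfolding p(2)[symmetric] using that by (intro Max_ge) auto
    obtain h where h: "g = p * h" using p factor_of_mem_factorisation by blast
    have pP: "p \<in> P" using p mem_factorisation_prime by blast
    have "smooth P nrm (nrm p) h"
      using max by (auto simp: smooth_def h factorisation_mult)
    moreover have "nrm h \<le> x / nrm p"
      using g nrm_pos[of p] by (simp add: B_def h nrm_mult field_simps)
    moreover have "nrm p \<le> x"
      using nrm_le_of_mem_factorisation[OF p(1)] g by (simp add: B_def)
    moreover have "y < nrm p" using max[OF p0(1)] p0(2) by linarith
    ultimately have "(p, h) \<in> D" using pP by (auto simp: D_def)
    then show "g \<in> m ` D" by (force simp: m_def h)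
  qed
  have inj: "inj_on m (D - E)"
  proof (rule inj_onI)
    fix a b assume a: "a \<in> D - E" and b: "b \<in> D - E" and eq: "m a = m b"
    obtain p h where ph: "a = (p, h)" by fastforce
    obtain q k where qk: "b = (q, k)" by fastforce
    have e: "p * h = q * k" using eq by (simp add: m_def ph qk)
    have P: "p \<in> P" "q \<in> P" "smooth P nrm (nrm p) h" "smooth P nrm (nrm q) k"
      using a b by (auto simp: D_def ph qk)
    have "p = q"
    proof (rule ccontr)
      assume "p \<noteq> q"
      have "add_mset p (factorisation P h) = add_mset q (factorisation P k)"
        using arg_cong[OF e, of "factorisation P"] P by (simp add: factorisation_mult factorisation_prime)
      then have "q \<in># add_mset p (factorisation P h)" "p \<in># add_mset q (factorisation P k)"
        by (metis union_single_eq_member)+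
      then have qp: "q \<in># factorisation P h" "p \<in># factorisation P k" using \<open>p \<noteq> q\<close> by auto
      then have "nrm q = nrm p" using P by (force simp: smooth_def)
      then have "a \<in> E" using a P qp \<open>p \<noteq> q\<close> by (auto simp: E_def ph)
      then show False using a by simp
    qed
    then show "a = b" using e by (simp add: ph qk mult_left_cancel)
  qed
  have finq: "finite (?q p)" for p
    by (rule finite_subset[OF _ finite_elems[of "nrm p"]]) auto
  have cardE: "real (card E) \<le> (\<Sum>p\<in>?I. real (card (?q p)) * real (N_count nrm (x / nrm p ^ 2)))"
  proof -
    let ?A = "\<lambda>p. \<Union>q\<in>?q p. (*) q ` {k. nrm k \<le> x / nrm p ^ 2}"
    have "E \<subseteq> Sigma ?I ?A"
    proof
      fix a assume a: "a \<in> E"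
      obtain p h where ph: "a = (p, h)" by fastforce
      obtain q where q: "q \<in> P" "nrm q = nrm p" "q \<in># factorisation P h" and D: "(p, h) \<in> D"
        using a by (auto simp: E_def ph)
      obtain k where k: "h = q * k" using q factor_of_mem_factorisation by blast
      have "nrm k \<le> x / nrm p ^ 2"
        using D nrm_pos[of p] q by (auto simp: D_def k nrm_mult field_simps power2_eq_square)
      then show "a \<in> Sigma ?I ?A" using D q by (auto simp: ph D_def k)
    qed
    then have "card E \<le> card (Sigma ?I ?A)"
      using I finq finite_elems by (intro card_mono finite_SigmaI) auto
    also have "\<dots> = (\<Sum>p\<in>?I. card (?A p))"
      using I finq finite_elems by (intro card_SigmaI) auto
    also have "\<dots> \<le> (\<Sum>p\<in>?I. card (?q p) * N_count nrm (x / nrm p ^ 2))"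
    proof (rule sum_mono)
      fix p
      have "card (?A p) \<le> (\<Sum>q\<in>?q p. card ((*) q ` {k. nrm k \<le> x / nrm p ^ 2}))"
        using finq by (rule card_UN_le)
      also have "\<dots> \<le> (\<Sum>q\<in>?q p. N_count nrm (x / nrm p ^ 2))"
        unfolding N_count_def by (intro sum_mono card_image_le finite_elems)
      finally show "card (?A p) \<le> card (?q p) * N_count nrm (x / nrm p ^ 2)" by simp
    qed
    finally have "real (card E) \<le> real (\<Sum>p\<in>?I. card (?q p) * N_count nrm (x / nrm p ^ 2))"
      by (rule of_nat_mono)
    then show ?thesis by simp
  qed
  have "E \<subseteq> D" by (auto simp: E_def)
  then have "card D - card E = card (D - E)"
    using finD finite_subset by (subst card_Diff_subset) auto
  also have "\<dots> = card (m ` (D - E))" using inj by (simp add: card_image)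
  also have "\<dots> \<le> card B" using finB image by (intro card_mono) auto
  finally have "card D \<le> card B + card E" by simp
  moreover have "card B \<le> card D" using card_image_le[OF finD, of m] image by simp
  ultimately have "\<bar>real (card B) - real (card D)\<bar> \<le> real (card E)" by linarith
  then show ?thesis using cardE unfolding cardB cardD by linarith
qed

end

section \<open>Error terms in Buchstab's identity and the induction\<close>

context axiom_A_semigroup
begin

text \<open>Chebyshev's bound at \<open>x = v\<close>, where primes of norm \<open>v\<close> have
  weight 1.\<close>

lemma card_primes_eq_norm:
  assumes "v > 1"
  shows "real (card {q \<in> P. nrm q = v}) * ln v \<le> C2 * v"
proof -
  have "real (card {q \<in> P. nrm q = v}) * ln v
      = (\<Sum>q | q \<in> P \<and> nrm q = v. ln (nrm q) * (v / nrm q) powr \<eta>)"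
    using assms by simp
  also have "\<dots> \<le> (\<Sum>q\<in>primes v. ln (nrm q) * (v / nrm q) powr \<eta>)"
    by (rule sum_mono2) (use finite_primes_le primeD in \<open>auto simp: less_imp_le\<close>)
  also have "\<dots> \<le> C2 * v" using assms by (intro C2(2)) auto
  finally show ?thesis .
qed

text \<open>Mertens' theorem with \<open>ln (nrm p)\<close> bounded below by \<open>ln y\<close>:
  crude, but O(1) when u is bounded and \<open>ln x\<close> is not small.\<close>

lemma sum_inverse_primes_le:
  assumes x: "x \<ge> 1" and y: "y > 1"
  shows "(\<Sum>p | p \<in> P \<and> y < nrm p \<and> nrm p \<le> x. 1 / nrm p) \<le> (ln x + M0) / ln y"
proof -
  have "ln y * (\<Sum>p | p \<in> P \<and> y < nrm p \<and> nrm p \<le> x. 1 / nrm p)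
      \<le> (\<Sum>p | p \<in> P \<and> y < nrm p \<and> nrm p \<le> x. ln (nrm p) / nrm p)"
    unfolding sum_distrib_left
    using y nrm_pos by (intro sum_mono) (auto intro!: divide_right_mono simp: less_imp_le)
  also have "\<dots> \<le> (\<Sum>p\<in>primes x. ln (nrm p) / nrm p)"
    by (rule sum_mono2)
      (use finite_primes_le nrm_pos nrm_ge_1 in \<open>auto simp: less_imp_le\<close>)
  also have "\<dots> \<le> ln x + M0" using mertens[OF x] by linarith
  finally show ?thesis using y by (simp add: pos_le_divide_eq mult.commute)
qed

text \<open>Primes of one norm number at most \<open>C2 * nrm p / ln y\<close>, while two factors of
  that norm cut the count to \<open>C0 * (x / nrm p ^ 2)\<close>; the product saves
  \<open>ln y\<close> over \<open>x / nrm p\<close>.\<close>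

lemma tie_count_le:
  assumes x: "x \<ge> 1" and y: "y > 1"
  shows "(\<Sum>p | p \<in> P \<and> y < nrm p \<and> nrm p \<le> x.
      real (card {q \<in> P. nrm q = nrm p}) * N (x / nrm p ^ 2))
    \<le> C0 * C2 * x * ((ln x + M0) / ln y) / ln y"
proof -
  have "(\<Sum>p | p \<in> P \<and> y < nrm p \<and> nrm p \<le> x.
      real (card {q \<in> P. nrm q = nrm p}) * N (x / nrm p ^ 2))
    \<le> (\<Sum>p | p \<in> P \<and> y < nrm p \<and> nrm p \<le> x. C0 * C2 * x / ln y * (1 / nrm p))"
  proof (rule sum_mono)
    fix p assume p: "p \<in> {p. p \<in> P \<and> y < nrm p \<and> nrm p \<le> x}"
    then have p1: "nrm p > 1" using primeD by auto
    let ?c = "real (card {q \<in> P. nrm q = nrm p})"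
    have "?c * ln y \<le> ?c * ln (nrm p)" using p y by (intro mult_left_mono) auto
    also have "\<dots> \<le> C2 * nrm p" using p1 by (rule card_primes_eq_norm)
    finally have "?c \<le> C2 * nrm p / ln y" using y by (simp add: pos_le_divide_eq)
    moreover have "N (x / nrm p ^ 2) \<le> C0 * (x / nrm p ^ 2)"
      using x p1 by (intro N_le) auto
    ultimately have "?c * N (x / nrm p ^ 2) \<le> C2 * nrm p / ln y * (C0 * (x / nrm p ^ 2))"
      using C2(1) y p1 by (intro mult_mono) auto
    also have "\<dots> = C0 * C2 * x / ln y * (1 / nrm p)"
      using p1 by (simp add: power2_eq_square)
    finally show "?c * N (x / nrm p ^ 2) \<le> C0 * C2 * x / ln y * (1 / nrm p)" .
  qed
  also have "\<dots> = C0 * C2 * x / ln y * (\<Sum>p | p \<in> P \<and> y < nrm p \<and> nrm p \<le> x. 1 / nrm p)"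
    by (simp add: sum_distrib_left)
  also have "\<dots> \<le> C0 * C2 * x / ln y * ((ln x + M0) / ln y)"
    using sum_inverse_primes_le[OF x y] C0_pos C2(1) x y by (intro mult_left_mono) auto
  finally show ?thesis by (simp add: mult_ac)
qed

text \<open>\<open>dickman_weighted_sum\<close> in the variable \<open>ln (nrm p)\<close> with
  weights \<open>ln (nrm p) / nrm p\<close>; its hypothesis at \<open>t\<close> is Mertens' theorem
  at \<open>exp t\<close>.\<close>

lemma main_sum_bound:
  assumes x: "x > 1" and y: "y > 1" "y \<le> x" and U: "ln x / ln y \<le> U"
    and R: "R \<ge> 0" "\<forall>u\<in>{0..U}. \<bar>dickman u\<bar> \<le> R"
  shows "\<bar>(\<Sum>p | p \<in> P \<and> y < nrm p \<and> nrm p \<le> x. dickman (ln x / ln (nrm p) - 1) / nrm p)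
      - (1 - dickman (ln x / ln y))\<bar> \<le> (2 * M0 + 2 * R * U ^ 3 * (4 * M0 + 2)) / ln x"
proof -
  have eq: "{p. p \<in> primes x \<and> ln y < ln (nrm p) \<and> ln (nrm p) \<le> ln x}
      = {p. p \<in> P \<and> y < nrm p \<and> nrm p \<le> x}"
    using x y nrm_pos by auto
  have "(\<Sum>p | p \<in> P \<and> y < nrm p \<and> nrm p \<le> x. dickman (ln x / ln (nrm p) - 1) / nrm p)
      = (\<Sum>p | p \<in> primes x \<and> ln y < ln (nrm p) \<and> ln (nrm p) \<le> ln x.
          ln (nrm p) / nrm p * (dickman (ln x / ln (nrm p) - 1) / ln (nrm p)))"
    unfolding eq using primeD(1) by (intro sum.cong) force+
  also have "\<bar>\<dots> - (1 - dickman (ln x / ln y))\<bar>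
      \<le> (2 * M0 + 2 * R * U ^ 3 * (4 * M0 + 2)) / ln x"
  proof (rule dickman_weighted_sum[OF finite_primes_le])
    fix t assume t: "ln y \<le> t" "t \<le> ln x"
    have "ln (nrm p) \<le> t \<longleftrightarrow> nrm p \<le> exp t" for p
      using nrm_pos[of p] by (metis exp_le_cancel_iff exp_ln)
    moreover have "exp t \<le> x" using t x by (metis exp_le_cancel_iff exp_ln less_trans zero_less_one)
    ultimately have "{p. p \<in> primes x \<and> ln (nrm p) \<le> t} = primes (exp t)" by force
    moreover have "0 < ln y" using y by simp
    then have "t \<ge> 0" using t by linarith
    ultimately show "\<bar>(\<Sum>p | p \<in> primes x \<and> ln (nrm p) \<le> t. ln (nrm p) / nrm p) - t\<bar> \<le> M0"
      using mertens[of "exp t"] by simp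
  qed (use x y U R nrm_pos nrm_ge_1 in \<open>auto simp: less_imp_le\<close>)
  finally show ?thesis .
qed

lemma Psi_le_N: "real (Psi P nrm x y) \<le> N x"
  unfolding Psi_def N_count_def using finite_elems by (auto intro!: card_mono)

lemma K_powr_eta_le:
  assumes "x > 1"
  shows "K * x powr \<eta> \<le> K / (1 - \<eta>) * (x / ln x)"
proof -
  have "x powr \<eta> \<le> x / (1 - \<eta>) / ln x"
    using assms ln_le_powr[of x] by (subst pos_le_divide_eq) auto
  then have "K * x powr \<eta> \<le> K * (x / (1 - \<eta>) / ln x)"
    using K_pos by (intro mult_left_mono) auto
  then show ?thesis by (simp add: mult_ac)
qed

lemma Psi_estimate_of_le:
  assumes x: "x > 1" and y: "y > 1" "x \<le> y"
  shows "\<bar>real (Psi P nrm x y) - A * x * dickman (ln x / ln y)\<bar> \<le> K / (1 - \<eta>) * x / ln x"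
proof -
  have "dickman (ln x / ln y) = 1"
    using x y by (intro dickman_eq_1) (auto simp: divide_le_eq)
  then have "\<bar>real (Psi P nrm x y) - A * x * dickman (ln x / ln y)\<bar> \<le> K * x powr \<eta>"
    using N_bound[of x] x y by (simp add: Psi_eq_N_count)
  also have "\<dots> \<le> K / (1 - \<eta>) * x / ln x" using K_powr_eta_le[OF x] by simp
  finally show ?thesis .
qed

text \<open>The range is all of \<open>x > 1\<close>, \<open>y > 1\<close> because the estimate is
  reused at \<open>x / nrm p\<close> and \<open>nrm p\<close>, and because rescaling the norm turns
  2 into \<open>2 powr \<delta>\<close>, possibly close to 1.\<close>

definition psi_estimate :: "nat \<Rightarrow> real \<Rightarrow> bool" where
  "psi_estimate n C \<longleftrightarrow> (\<forall>x>1. \<forall>y>1. ln x \<le> real n * ln y \<longrightarrow>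
    \<bar>real (Psi P nrm x y) - A * x * dickman (ln x / ln y)\<bar> \<le> C * x / ln x)"

text \<open>
  For \<open>nrm p\<close> above the square root of \<open>x\<close> the inner \<open>Psi\<close> counts all elements, and the error
  of \<open>N\<close> sums up by Chebyshev's bound; this avoids the loss of a factor \<open>ln (ln x)\<close> which
  the induction hypothesis would give for small \<open>x / nrm p\<close>.
\<close>

lemma inner_error_le:
  assumes IH: "psi_estimate n C" and C: "C \<ge> 0"
    and x: "x > 1" and y: "y > 1" "ln x \<le> real (Suc n) * ln y" and p: "p \<in> P" "y < nrm p" "nrm p \<le> x"
  shows "\<bar>real (Psi P nrm (x / nrm p) (nrm p)) - A * x * (dickman (ln x / ln (nrm p) - 1) / nrm p)\<bar>
    \<le> 2 * K / ln x * (ln (nrm p) * (x / nrm p) powr \<eta>) + 2 * C * x / ln x * (1 / nrm p)"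
proof -
  note p1 = primeD[OF p(1)]
  have lnx: "ln x > 0" using x by simp
  have lnq: "ln (x / nrm p) = ln x - ln (nrm p)" using x p1 by (simp add: ln_div)
  then have u: "ln (x / nrm p) / ln (nrm p) = ln x / ln (nrm p) - 1"
    using p1 by (simp add: diff_divide_distrib)
  have first: "0 \<le> 2 * K / ln x * (ln (nrm p) * (x / nrm p) powr \<eta>)"
    and second: "0 \<le> 2 * C * x / ln x * (1 / nrm p)"
    using K_pos C lnx p1 x by simp_all
  show ?thesis
  proof (cases "ln x \<le> 2 * ln (nrm p)")
    case True
    have "x / nrm p \<le> nrm p"
    proof -
      have "ln (x / nrm p) \<le> ln (nrm p)" using True lnq by simp
      then show ?thesis using x p1 by simp
    qed
    then have Psi: "real (Psi P nrm (x / nrm p) (nrm p)) = N (x / nrm p)"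
      by (simp add: Psi_eq_N_count)
    have "ln (nrm p) \<le> ln x" using p p1 x by simp
    then have d: "dickman (ln x / ln (nrm p) - 1) = 1"
      using True p1 by (intro dickman_eq_1) (simp_all add: divide_le_eq le_divide_eq)
    have "\<bar>real (Psi P nrm (x / nrm p) (nrm p)) - A * x * (dickman (ln x / ln (nrm p) - 1) / nrm p)\<bar>
        \<le> K * (x / nrm p) powr \<eta>"
      using N_bound[of "x / nrm p"] p p1 unfolding Psi d by simp
    \<comment> \<open>The inserted factor is at least 1 for these primes; it supplies both the
      weight \<open>ln (nrm p)\<close> of Chebyshev's bound and the saving
      \<open>1 / ln x\<close>.\<close>
    also have "\<dots> \<le> (2 * ln (nrm p) / ln x) * (K * (x / nrm p) powr \<eta>)"
      using True lnx K_pos mult_right_mono[of 1 "2 * ln (nrm p) / ln x" "K * (x / nrm p) powr \<eta>"] by simp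
    also have "\<dots> = 2 * K / ln x * (ln (nrm p) * (x / nrm p) powr \<eta>)" by simp
    finally show ?thesis using second by linarith
  next
    case False
    \<comment> \<open>The induction hypothesis gives an error over \<open>ln (x / nrm p)\<close>,
      which here is at least half of \<open>ln x\<close>.\<close>
    have q: "2 * ln (x / nrm p) \<ge> ln x" using False lnq by simp
    have q1: "x / nrm p > 1"
    proof -
      have "ln (x / nrm p) > 0" using q lnx by linarith
      then show ?thesis using x p1 by (simp add: ln_gt_zero_iff)
    qed
    \<comment> \<open>Dividing by a prime of norm above \<open>y\<close> lowers u by at least one:
      ln x / ln (nrm p) - 1 \<le> n.\<close>
    have "ln y \<le> ln (nrm p)" using y p p1 by simp
    then have "real (Suc n) * ln y \<le> real (Suc n) * ln (nrm p)" by (intro mult_left_mono) auto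
    then have "ln (x / nrm p) \<le> real n * ln (nrm p)"
      using y(2) lnq by (simp add: algebra_simps)
    then have "\<bar>real (Psi P nrm (x / nrm p) (nrm p))
        - A * (x / nrm p) * dickman (ln (x / nrm p) / ln (nrm p))\<bar>
        \<le> C * (x / nrm p) / ln (x / nrm p)"
      using IH q1 p1 unfolding psi_estimate_def by blast
    also have "\<dots> \<le> C * (x / nrm p) / (ln x / 2)"
    proof (intro divide_left_mono mult_pos_pos)
      show "0 < ln (x / nrm p)" using q lnx by linarith
    qed (use q lnx C x p1 in auto)
    finally show ?thesis using first unfolding u by (simp add: mult_ac)
  qed
qed

lemma psi_estimate_step:
  assumes IH: "psi_estimate n C" and C: "C \<ge> 0"
  shows "\<exists>C'\<ge>0. psi_estimate (Suc n) C'"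
proof -
  define U where "U = real (Suc n)"
  have U: "U \<ge> 1" by (simp add: U_def)
  obtain R where R: "R \<ge> 1" "\<forall>u\<in>{0..U}. \<bar>dickman u\<bar> \<le> R" using dickman_bounded by blast
  \<comment> \<open>\<open>E1\<close> covers the error of \<open>N x\<close> and the range u \<le>
    1, \<open>E2\<close> the trivial bound for small \<open>x\<close>; after \<open>K\<close>, the
    terms of \<open>E3\<close> are the ties, the inner errors and the partial summation
    error.\<close>
  define E1 where "E1 = K / (1 - \<eta>)"
  define E2 where "E2 = 2 * (C0 + A * R)"
  define E3 where "E3 = K + C0 * C2 * (1 + M0) * U * U + (2 * K * C2 + 2 * C * (1 + M0) * U)
      + A * (2 * M0 + 2 * R * U ^ 3 * (4 * M0 + 2))"
  have E1: "E1 \<ge> 0" using K_pos eta_less_1 by (simp add: E1_def)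
  have E2: "E2 \<ge> 0" using A_pos C0_pos R by (simp add: E2_def)
  have E3: "E3 \<ge> 0"
    unfolding E3_def using A_pos C0_pos R K_pos C2(1) M0_pos U C by (intro add_nonneg_nonneg) auto
  have "\<bar>real (Psi P nrm x y) - A * x * dickman (ln x / ln y)\<bar> \<le> (E1 + E2 + E3) * x / ln x"
    if x: "x > 1" and y: "y > 1" and xy: "ln x \<le> U * ln y" for x y
  proof -
    have lnx: "ln x > 0" and lny: "ln y > 0" using x y by auto
    have u: "0 < ln x / ln y" "ln x / ln y \<le> U"
      using lnx lny xy by (auto simp: pos_divide_le_eq)
    have xy': "ln x \<le> real (Suc n) * ln y" using xy by (simp only: U_def)
    have nonneg: "E1 * x / ln x \<ge> 0" "E2 * x / ln x \<ge> 0" "E3 * x / ln x \<ge> 0"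
      using E1 E2 E3 x lnx by auto
    have sum: "(E1 + E2 + E3) * x / ln x = E1 * x / ln x + E2 * x / ln x + E3 * x / ln x"
      by (simp add: distrib_right add_divide_distrib)
    \<comment> \<open>In the last case \<open>ln x\<close> is large enough to absorb
      \<open>M0\<close> into \<open>M0 * ln x\<close>.\<close>
    consider "x \<le> y" | "ln x \<le> 2" | "y < x" "ln x > 2" by linarith
    then show ?thesis
    proof cases
      case 1
      have "\<bar>real (Psi P nrm x y) - A * x * dickman (ln x / ln y)\<bar> \<le> E1 * x / ln x"
        unfolding E1_def by (rule Psi_estimate_of_le[OF x y 1])
      then show ?thesis using nonneg unfolding sum by linarith
    next
      case 2
      have "real (Psi P nrm x y) \<le> C0 * x" using Psi_le_N[of x y] N_le[of x] x by linarith
      moreover have "\<bar>A * x * dickman (ln x / ln y)\<bar> \<le> A * x * R"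
        using R u A_pos x by (auto simp: abs_mult intro!: mult_left_mono)
      ultimately have "\<bar>real (Psi P nrm x y) - A * x * dickman (ln x / ln y)\<bar> \<le> (C0 + A * R) * x"
        by (simp add: algebra_simps)
      also have "\<dots> \<le> E2 * x / ln x"
      proof -
        have "(C0 + A * R) * x * ln x \<le> (C0 + A * R) * x * 2"
          using 2 C0_pos A_pos R x by (intro mult_left_mono) auto
        then show ?thesis using lnx by (simp add: pos_le_divide_eq E2_def mult_ac)
      qed
      finally show ?thesis using nonneg unfolding sum by linarith
    next
      case 3
      let ?I = "{p. p \<in> P \<and> y < nrm p \<and> nrm p \<le> x}"
      let ?B = "\<Sum>p\<in>?I. real (Psi P nrm (x / nrm p) (nrm p))"
      let ?S = "\<Sum>p\<in>?I. dickman (ln x / ln (nrm p) - 1) / nrm p"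
      let ?X = "x / ln x"
      have X: "?X > 0" using x lnx by simp
      have lnyU: "1 / ln y \<le> U / ln x" using xy lnx lny by (simp add: field_simps)
      have lnM: "ln x + M0 \<le> (1 + M0) * ln x"
      proof -
        have "M0 * 1 \<le> M0 * ln x" using 3 M0_pos by (intro mult_left_mono) auto
        then show ?thesis by (simp add: algebra_simps)
      qed
      have ratio: "(ln x + M0) / ln y \<le> (1 + M0) * U"
      proof -
        have "(ln x + M0) * (1 / ln y) \<le> ((1 + M0) * ln x) * (U / ln x)"
          using lnM lnyU lnx lny M0_pos by (intro mult_mono) auto
        then show ?thesis using lnx by simp
      qed
      have 1: "\<bar>N x - A * x\<bar> \<le> E1 * ?X"
        using N_bound[of x] K_powr_eta_le[OF x] x unfolding E1_def by linarith
      have 2: "\<bar>N x - real (Psi P nrm x y) - ?B\<bar> \<le> C0 * C2 * (1 + M0) * U * U * ?X"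
      proof -
        have "\<bar>N x - real (Psi P nrm x y) - ?B\<bar> \<le> C0 * C2 * x * ((ln x + M0) / ln y) * (1 / ln y)"
          using buchstab[of x y] tie_count_le[of x y] x y by simp
        also have "\<dots> \<le> C0 * C2 * x * ((1 + M0) * U) * (U / ln x)"
          using ratio lnyU C0_pos C2(1) x M0_pos U lny by (intro mult_mono mult_left_mono) auto
        finally show ?thesis by (simp add: mult_ac)
      qed
      have 3: "\<bar>?B - A * x * ?S\<bar> \<le> (2 * K * C2 + 2 * C * (1 + M0) * U) * ?X"
      proof -
        have eq: "?B - A * x * ?S = (\<Sum>p\<in>?I. real (Psi P nrm (x / nrm p) (nrm p))
            - A * x * (dickman (ln x / ln (nrm p) - 1) / nrm p))"
          by (simp only: sum_distrib_left sum_subtractf)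
        have "\<bar>?B - A * x * ?S\<bar> \<le> (\<Sum>p\<in>?I. 2 * K / ln x * (ln (nrm p) * (x / nrm p) powr \<eta>)
            + 2 * C * x / ln x * (1 / nrm p))"
          unfolding eq
        proof (rule order_trans[OF sum_abs sum_mono])
          fix p assume "p \<in> ?I"
          then show "\<bar>real (Psi P nrm (x / nrm p) (nrm p))
              - A * x * (dickman (ln x / ln (nrm p) - 1) / nrm p)\<bar>
            \<le> 2 * K / ln x * (ln (nrm p) * (x / nrm p) powr \<eta>) + 2 * C * x / ln x * (1 / nrm p)"
            by (intro inner_error_le[OF IH C x y xy']) simp_all
        qed
        also have "\<dots> = 2 * K / ln x * (\<Sum>p\<in>?I. ln (nrm p) * (x / nrm p) powr \<eta>)
            + 2 * C * x / ln x * (\<Sum>p\<in>?I. 1 / nrm p)"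
          by (subst (1 2) sum_distrib_left) (rule sum.distrib)
        also have "\<dots> \<le> 2 * K / ln x * (C2 * x) + 2 * C * x / ln x * ((1 + M0) * U)"
        proof (rule add_mono; rule mult_left_mono)
          have "(\<Sum>p\<in>?I. ln (nrm p) * (x / nrm p) powr \<eta>)
              \<le> (\<Sum>p\<in>primes x. ln (nrm p) * (x / nrm p) powr \<eta>)"
            by (rule sum_mono2) (use finite_primes_le primeD in \<open>auto simp: less_imp_le\<close>)
          also have "\<dots> \<le> C2 * x" using x by (intro C2(2)) auto
          finally show "(\<Sum>p\<in>?I. ln (nrm p) * (x / nrm p) powr \<eta>) \<le> C2 * x" .
          show "(\<Sum>p\<in>?I. 1 / nrm p) \<le> (1 + M0) * U"
            using sum_inverse_primes_le[of x y] ratio x y by linarith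
        qed (use K_pos lnx C x in auto)
        also have "\<dots> = (2 * K * C2 + 2 * C * (1 + M0) * U) * ?X"
          by (simp add: algebra_simps add_divide_distrib)
        finally show ?thesis .
      qed
      have 4: "\<bar>A * x * ?S - A * x * (1 - dickman (ln x / ln y))\<bar>
          \<le> A * (2 * M0 + 2 * R * U ^ 3 * (4 * M0 + 2)) * ?X"
      proof -
        have "\<bar>?S - (1 - dickman (ln x / ln y))\<bar> \<le> (2 * M0 + 2 * R * U ^ 3 * (4 * M0 + 2)) / ln x"
          using x y \<open>y < x\<close> u R by (intro main_sum_bound) auto
        then have "A * x * \<bar>?S - (1 - dickman (ln x / ln y))\<bar>
            \<le> A * x * ((2 * M0 + 2 * R * U ^ 3 * (4 * M0 + 2)) / ln x)"
          using A_pos x by (intro mult_left_mono) auto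
        moreover have "\<bar>A * x * ?S - A * x * (1 - dickman (ln x / ln y))\<bar>
            = A * x * \<bar>?S - (1 - dickman (ln x / ln y))\<bar>"
          unfolding right_diff_distrib[symmetric] using A_pos x by (simp add: abs_mult)
        ultimately show ?thesis by (simp add: mult_ac)
      qed
      define d where "d = dickman (ln x / ln y)"
      \<comment> \<open>Buchstab's sum contributes \<open>A * x * (1 - d)\<close>; taken from the
        main term \<open>A * x\<close> of \<open>N x\<close> it leaves
        \<open>A * x * d\<close>.\<close>
      have "A * x * (1 - d) = A * x - A * x * d" by (simp add: algebra_simps)
      then have "\<bar>real (Psi P nrm x y) - A * x * d\<bar>
          \<le> E1 * ?X + C0 * C2 * (1 + M0) * U * U * ?X + (2 * K * C2 + 2 * C * (1 + M0) * U) * ?X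
            + A * (2 * M0 + 2 * R * U ^ 3 * (4 * M0 + 2)) * ?X"
        using 1 2 3 4 unfolding d_def[symmetric] by linarith
      also have "\<dots> = (E1 + (E3 - K)) * ?X"
        unfolding E3_def by (simp only: distrib_right[symmetric]) (simp add: add_ac)
      also have "\<dots> \<le> (E1 + E2 + E3) * ?X"
        using X E2 K_pos by (intro mult_right_mono) auto
      finally show ?thesis by (simp add: d_def)
    qed
  qed
  then have "psi_estimate (Suc n) (E1 + E2 + E3)"
    unfolding psi_estimate_def U_def by blast
  then show ?thesis using E1 E2 E3 by (intro exI[of _ "E1 + E2 + E3"]) auto
qed

lemma psi_estimate_exists: "\<exists>C\<ge>0. psi_estimate (Suc n) C"
proof (induction n)
  case 0
  have "K / (1 - \<eta>) \<ge> 0" using K_pos eta_less_1 by simp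
  moreover have "psi_estimate (Suc 0) (K / (1 - \<eta>))"
    unfolding psi_estimate_def using Psi_estimate_of_le by auto
  ultimately show ?case by blast
next
  case (Suc n)
  then show ?case using psi_estimate_step by auto
qed

end

subsection \<open>Reduction to density exponent one\<close>

lemma powr_le_iff_le_base: "x > 0 \<Longrightarrow> y > 0 \<Longrightarrow> \<delta> > 0 \<Longrightarrow> x powr \<delta> \<le> y powr \<delta> \<longleftrightarrow> x \<le> y"
  for x y \<delta> :: real
  by (metis less_imp_le not_le powr_less_mono2 powr_mono2)

text \<open>The count for the new norm at \<open>x\<close> is the old one at
  \<open>x powr (1 / \<delta>)\<close>, which turns the exponents \<delta> and \<eta> into 1 and
  \<eta>/\<delta> < 1.\<close>

lemma axiom_A_semigroup_powr:
  assumes G: "arithmetic_semigroup P nrm" and ax: "axiom_A nrm A \<delta> \<eta>"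
  obtains K where "axiom_A_semigroup P (\<lambda>g. nrm g powr \<delta>) A (\<eta> / \<delta>) K"
proof -
  interpret arithmetic_semigroup P nrm by (rule G)
  let ?N = "\<lambda>x. real (N_count nrm x)"
  have A: "A > 0" "\<delta> > 0" "0 \<le> \<eta>" "\<eta> < \<delta>"
    and O: "(\<lambda>x. ?N x - A * x powr \<delta>) \<in> O[at_top](\<lambda>x. x powr \<eta>)"
    using ax by (auto simp: axiom_A_def)
  obtain c x0 where c: "c > 0" and x0: "\<And>x. x \<ge> x0 \<Longrightarrow> \<bar>?N x - A * x powr \<delta>\<bar> \<le> c * x powr \<eta>"
  proof -
    from O obtain c where "c > 0"
      "eventually (\<lambda>x. norm (?N x - A * x powr \<delta>) \<le> c * norm (x powr \<eta>)) at_top"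
      by (rule landau_o.bigE)
    then show ?thesis using that by (auto simp: eventually_at_top_linorder)
  qed
  define x1 where "x1 = max 1 x0"
  \<comment> \<open>Below the threshold \<open>x1\<close> both the count and its main term are at
    most their values at \<open>x1\<close>, and \<open>x powr \<eta>\<close> \<ge> 1; adding these
    values extends the bound down to 1.\<close>
  define K where "K = c + ?N x1 + A * x1 powr \<delta>"
  have K: "K > 0" using c A by (simp add: K_def add_pos_nonneg)
  have bound: "\<bar>?N x - A * x powr \<delta>\<bar> \<le> K * x powr \<eta>" if x: "x \<ge> 1" for x
  proof (cases "x \<ge> x0")
    case True
    have "c * x powr \<eta> \<le> K * x powr \<eta>" using A by (intro mult_right_mono) (auto simp: K_def)
    then show ?thesis using x0[OF True] by linarith
  next
    case False
    then have "x \<le> x1" by (simp add: x1_def)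
    then have "?N x \<le> ?N x1" "A * x powr \<delta> \<le> A * x1 powr \<delta>"
      using N_count_mono A x by (auto intro!: powr_mono2 mult_left_mono)
    moreover have "A * x powr \<delta> \<ge> 0" using A by simp
    ultimately have "\<bar>?N x - A * x powr \<delta>\<bar> \<le> K" using c unfolding K_def by linarith
    also have "\<dots> \<le> K * x powr \<eta>" using K A x ge_one_powr_ge_zero[of x \<eta>] by simp
    finally show ?thesis .
  qed
  have le: "nrm g powr \<delta> \<le> x \<longleftrightarrow> nrm g \<le> x powr (1 / \<delta>)" if "x > 0" for g x
  proof -
    have "x = (x powr (1 / \<delta>)) powr \<delta>" using that A by (simp add: powr_powr)
    then show ?thesis
      using powr_le_iff_le_base[of "nrm g" "x powr (1 / \<delta>)" \<delta>] nrm_pos[of g] A that by simp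
  qed
  have "axiom_A_semigroup P (\<lambda>g. nrm g powr \<delta>) A (\<eta> / \<delta>) K"
  proof (unfold_locales)
    show "nrm g powr \<delta> \<ge> 1" for g using nrm_ge_1[of g] A by (intro ge_one_powr_ge_zero) auto
    show "nrm p powr \<delta> > 1" if "p \<in> P" for p using nrm_prime[OF that] A by (intro gr_one_powr) auto
    show "nrm (f * g) powr \<delta> = nrm f powr \<delta> * nrm g powr \<delta>" for f g
      using nrm_pos[of f] nrm_pos[of g] by (simp add: nrm_mult powr_mult)
    show "finite {g. nrm g powr \<delta> \<le> x}" if "x > 0" for x
      using finite_elems[of "x powr (1 / \<delta>)"] le[OF that] by simp
    fix x :: real assume x: "x \<ge> 1"
    have "N_count (\<lambda>g. nrm g powr \<delta>) x = N_count nrm (x powr (1 / \<delta>))"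
      using le[of x] x by (simp add: N_count_def)
    moreover have "(x powr (1 / \<delta>)) powr \<delta> = x" using x A by (simp add: powr_powr)
    moreover have "(x powr (1 / \<delta>)) powr \<eta> = x powr (\<eta> / \<delta>)" by (simp add: powr_powr)
    moreover have "x powr (1 / \<delta>) \<ge> 1" using x A by (intro ge_one_powr_ge_zero) auto
    ultimately show "\<bar>real (N_count (\<lambda>g. nrm g powr \<delta>) x) - A * x\<bar> \<le> K * x powr (\<eta> / \<delta>)"
      using bound[of "x powr (1 / \<delta>)"] by simp
  qed (use A K nrm_one countable_primes unique_factorisation in auto)
  then show ?thesis using that by blast
qed

lemma Psi_powr:
  assumes "arithmetic_semigroup P nrm" "\<delta> > 0" "x > 0" "y > 0"
  shows "Psi P (\<lambda>g. nrm g powr \<delta>) (x powr \<delta>) (y powr \<delta>) = Psi P nrm x y"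
proof -
  interpret arithmetic_semigroup P nrm by fact
  have le: "nrm g powr \<delta> \<le> z powr \<delta> \<longleftrightarrow> nrm g \<le> z" if "z > 0" for g z
    using powr_le_iff_le_base that nrm_pos assms(2) by blast
  show ?thesis unfolding Psi_def smooth_def using le assms by simp
qed

theorem theorem1p1:
  fixes P :: "'a::comm_monoid_mult set"
    and nrm :: "'a \<Rightarrow> real"
    and A \<delta> \<eta> :: real
  assumes "arithmetic_semigroup P nrm"
    and "axiom_A nrm A \<delta> \<eta>"
  shows "\<forall>U>0. \<exists>C>1. \<exists>x\<^sub>0>1. \<forall>x\<ge>x\<^sub>0. \<forall>y\<ge>2.
           0 < ln x / ln y \<and> ln x / ln y \<le> U \<longrightarrow>
           \<bar>real (Psi P nrm x y) - A * x powr \<delta> * dickman (ln x / ln y)\<bar>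
             \<le> C * (x powr \<delta> / ln x)"
proof (intro allI impI)
  fix U :: real assume "U > 0"
  have \<delta>: "\<delta> > 0" using assms(2) by (simp add: axiom_A_def)
  obtain K where K: "axiom_A_semigroup P (\<lambda>g. nrm g powr \<delta>) A (\<eta> / \<delta>) K"
    using axiom_A_semigroup_powr[OF assms] .
  interpret axiom_A_semigroup P "\<lambda>g. nrm g powr \<delta>" A "\<eta> / \<delta>" K by (rule K)
  obtain n where n: "U \<le> real n" using real_arch_simple by blast
  obtain C where C: "C \<ge> 0" "psi_estimate (Suc n) C" using psi_estimate_exists by blast
  \<comment> \<open>u is unchanged by the rescaling, while \<open>ln (x powr \<delta>)\<close> =
    \<delta> ln x puts \<delta> under \<open>C\<close>; the added 2 makes the constant exceed
    1.\<close>
  have "\<bar>real (Psi P nrm x y) - A * x powr \<delta> * dickman (ln x / ln y)\<bar>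
      \<le> (C / \<delta> + 2) * (x powr \<delta> / ln x)"
    if x: "x \<ge> 2" and y: "y \<ge> 2" and u: "ln x / ln y \<le> U" for x y :: real
  proof -
    have "x powr \<delta> > 1" "y powr \<delta> > 1" using x y \<delta> by (auto intro!: gr_one_powr)
    moreover have "ln (x powr \<delta>) \<le> real (Suc n) * ln (y powr \<delta>)"
    proof -
      have "ln x / ln y \<le> real (Suc n)" using u n by simp
      then have "ln x \<le> real (Suc n) * ln y" using y by (simp add: pos_divide_le_eq)
      then have "\<delta> * ln x \<le> \<delta> * (real (Suc n) * ln y)" using \<delta> by (intro mult_left_mono) auto
      then show ?thesis using x y by (simp add: ln_powr mult_ac)
    qed
    ultimately have "\<bar>real (Psi P (\<lambda>g. nrm g powr \<delta>) (x powr \<delta>) (y powr \<delta>))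
        - A * x powr \<delta> * dickman (ln (x powr \<delta>) / ln (y powr \<delta>))\<bar>
        \<le> C * x powr \<delta> / ln (x powr \<delta>)"
      using C(2) unfolding psi_estimate_def by blast
    also have "Psi P (\<lambda>g. nrm g powr \<delta>) (x powr \<delta>) (y powr \<delta>) = Psi P nrm x y"
      using x y by (intro Psi_powr[OF assms(1) \<delta>]) auto
    also have "ln (x powr \<delta>) / ln (y powr \<delta>) = ln x / ln y"
      using x y \<delta> by (simp add: ln_powr)
    also have "C * x powr \<delta> / ln (x powr \<delta>) = C / \<delta> * (x powr \<delta> / ln x)"
      using x by (simp add: ln_powr)
    also have "\<dots> \<le> (C / \<delta> + 2) * (x powr \<delta> / ln x)"
      using x by (intro mult_right_mono) auto
    finally show ?thesis .
  qed
  moreover have "C / \<delta> \<ge> 0" using C(1) \<delta> by simp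
  then have "C / \<delta> + 2 > 1" by linarith
  ultimately show "\<exists>C>1. \<exists>x\<^sub>0>1. \<forall>x\<ge>x\<^sub>0. \<forall>y\<ge>2.
           0 < ln x / ln y \<and> ln x / ln y \<le> U \<longrightarrow>
           \<bar>real (Psi P nrm x y) - A * x powr \<delta> * dickman (ln x / ln y)\<bar>
             \<le> C * (x powr \<delta> / ln x)"
    by (intro exI[of _ "C / \<delta> + 2"] conjI exI[of _ 2] allI impI) auto
qed

end
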